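(* Let $T_H=(V_H,E_H,F_H)$ be the infinite hexagonal triangulation of the plane and let $d_{reg}\equiv1$ be the regular metric on $T_H$. There is a universal constant $\epsilon_0>0$ such that for every $\phi:V_H\to\mathbb R$ with $\|\phi\|_{l^2}\le\epsilon_0$, there exists a unique global solution $u(t)$, $t\in[0,\infty)$, to the combinatorial Yamabe flow $$\frac{\mathrm{d}u_i}{\mathrm{d}t}=-K_i(u(t)),\qquad u_i(0)=\phi_i,\qquad i\in V_H.$$ Moreover, $u(t)$ converges to the regular metric, i.e. $u(t)*d_{reg}\to d_{reg}$ as $t\to\infty$: for every edge $ij\in E_H$, $(u(t)*d_{reg})_{ij}\to1$.
   Context: $T_H$ is the triangulation of the plane by equilateral triangles in which every vertex has degree 6 (vertex set the triangular lattice); $V_H,E_H,F_H$ are its vertices, edges and faces, and $d_{reg}$ assigns length $1$ to every edge. $\|\phi\|_{l^2}=(\sum_{i\in V_H}|\phi_i|^2)^{1/2}$. A PL metric on $T_H$ is a function $l:E_H\to\mathbb R_{>0}$ such that for every triangle $\Delta ijk\in F_H$ the lengths $l_{ij},l_{ik},l_{jk}$ satisfy the (strict) triangle inequalities; $\theta_i^{jk}$ denotes the inner angle at vertex $i$ of the Euclidean triangle $\Delta ijk$ with these edge lengths. For $u:V_H\to\mathbb R$, $u*d_{reg}$ is the function on edges given by $(u*d_{reg})_{ij}=e^{\frac12(u_i+u_j)}$. When $u*d_{reg}$ is a PL metric, $K_i(u)=2\pi-\sum_{\Delta ijk\in F_H}\theta_i^{jk}$, where the angles are those of $u*d_{reg}$.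 A global solution of the flow is a function $u:V_H\times[0,\infty)\to\mathbb R$, differentiable in $t$ at each vertex, such that $u(t)*d_{reg}$ is a PL metric for every $t\ge0$ and the equations hold. *)

theory Defs
  imports "HOL-Analysis.Analysis"
begin

text \<open>
  The vertex set of the hexagonal triangulation is the triangular lattice; the pair
  \<open>(m, n)\<close> stands for the lattice point \<open>m + n * exp (\<i> * pi / 3)\<close> of the plane.
  An edge is the set of its two end points, a face the set of its three vertices.
\<close>

type_synonym vertex = "int \<times> int"

definition E_H :: "vertex set set" where
  "E_H = (\<Union>m n. {{(m, n), (m + 1, n)}, {(m, n), (m, n + 1)}, {(m + 1, n), (m, n + 1)}})"

definition F_H :: "vertex set set" where
  "F_H = (\<Union>m n. {{(m, n), (m + 1, n), (m, n + 1)}, {(m + 1, n), (m, n + 1), (m + 1, n + 1)}})"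

text \<open>
  Functions on edges are total functions on sets of vertices; their values outside
  \<^const>\<open>E_H\<close> are irrelevant. Since the vertices of a face can be enumerated in any order,
  the condition below contains all three triangle inequalities of each face.
\<close>

definition PL_metric :: "(vertex set \<Rightarrow> real) \<Rightarrow> bool" where
  "PL_metric l \<longleftrightarrow> (\<forall>e\<in>E_H. l e > 0) \<and>
     (\<forall>i j k. {i, j, k} \<in> F_H \<longrightarrow> l {j, k} < l {i, j} + l {i, k})"

definition d_reg :: "vertex set \<Rightarrow> real" where
  "d_reg e = 1"

definition conformal :: "(vertex \<Rightarrow> real) \<Rightarrow> (vertex set \<Rightarrow> real) \<Rightarrow> vertex set \<Rightarrow> real"
    (infixr "\<^bold>*" 70) where
  "(u \<^bold>* d) e = exp ((\<Sum>i\<in>e. u i) / 2) * d e"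

definition vangle :: "complex \<Rightarrow> complex \<Rightarrow> complex \<Rightarrow> real" where
  "vangle p q r = arccos (((q - p) \<bullet> (r - p)) / (norm (q - p) * norm (r - p)))"

text \<open>
  The inner angle at \<open>i\<close> of the face \<open>\<Delta>\<close> is measured in any triangle \<open>p q r\<close> of the
  Euclidean plane, identified with \<^typ>\<open>complex\<close>, that has the prescribed edge lengths.
  For PL metrics it is well defined; see \<open>inner_angle_cosine_law\<close> below.
\<close>

definition inner_angle :: "(vertex set \<Rightarrow> real) \<Rightarrow> vertex \<Rightarrow> vertex set \<Rightarrow> real" where
  "inner_angle l i \<Delta> = (THE \<theta>. \<exists>j k p q r. \<Delta> = {i, j, k} \<and>
     dist p q = l {i, j} \<and> dist p r = l {i, k} \<and> dist q r = l {j, k} \<and> \<theta> = vangle p q r)"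

definition curvature :: "(vertex \<Rightarrow> real) \<Rightarrow> vertex \<Rightarrow> real" where
  "curvature u i = 2 * pi - (\<Sum>\<Delta> | \<Delta> \<in> F_H \<and> i \<in> \<Delta>. inner_angle (u \<^bold>* d_reg) i \<Delta>)"

text \<open>
  A solution is only constrained on \<open>[0, \<infinity>)\<close>; the derivative at \<open>t = 0\<close> is one-sided.
\<close>

definition global_solution :: "(vertex \<Rightarrow> real) \<Rightarrow> (real \<Rightarrow> vertex \<Rightarrow> real) \<Rightarrow> bool" where
  "global_solution \<phi> u \<longleftrightarrow>
     (\<forall>t\<ge>0. PL_metric (u t \<^bold>* d_reg)) \<and>
     (\<forall>t\<ge>0. \<forall>i. ((\<lambda>s. u s i) has_real_derivative - curvature (u t) i) (at t within {0..})) \<and>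
     (\<forall>i. u 0 i = \<phi> i)"

text \<open>
  \<^const>\<open>infsum\<close> is \<open>0\<close> for families that are not summable, so membership in \<open>l2\<close> has to be
  required separately.
\<close>

definition in_l2 :: "(vertex \<Rightarrow> real) \<Rightarrow> bool" where
  "in_l2 \<phi> \<longleftrightarrow> (\<lambda>i. \<bar>\<phi> i\<bar>\<^sup>2) summable_on UNIV"

definition l2_norm :: "(vertex \<Rightarrow> real) \<Rightarrow> real" where
  "l2_norm \<phi> = sqrt (\<Sum>\<^sub>\<infinity>i. \<bar>\<phi> i\<bar>\<^sup>2)"

lemma conformal_edge:
  assumes "i \<noteq> j"
  shows "(u \<^bold>* d_reg) {i, j} = exp ((u i + u j) / 2)"
  using assms by (simp add: conformal_def d_reg_def)

lemma face_distinct: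
  assumes "{i, j, k} \<in> F_H"
  shows "i \<noteq> j" "i \<noteq> k" "j \<noteq> k"
proof -
  have "card {(m, n), (m + 1, n), (m, n + 1)} = 3"
    "card {(m + 1, n), (m, n + 1), (m + 1, n + 1)} = 3" for m n :: int
    by auto
  then have "card {i, j, k} = 3"
    using assms unfolding F_H_def by force
  then show "i \<noteq> j" "i \<noteq> k" "j \<noteq> k"
    by (auto simp: card_insert_if split: if_splits)
qed

lemma face_edge:
  assumes "{i, j, k} \<in> F_H"
  shows "{i, j} \<in> E_H"
proof -
  have E: "{(m, n), (m + 1, n)} \<in> E_H" "{(m, n), (m, n + 1)} \<in> E_H"
      "{(m + 1, n), (m, n + 1)} \<in> E_H" for m n
    by (auto simp: E_H_def)
  have E2: "{(m, n + 1), (m + 1, n + 1)} \<in> E_H" "{(m + 1, n), (m + 1, n + 1)} \<in> E_H" for m n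
    using E(1)[of m "n + 1"] E(2)[of "m + 1" n] by auto
  obtain a b c where abc: "{i, j, k} = {a, b, c}" "{a, b} \<in> E_H" "{a, c} \<in> E_H" "{b, c} \<in> E_H"
    using assms E E2 unfolding F_H_def by blast
  have ij: "i \<noteq> j" "i \<in> {a, b, c}" "j \<in> {a, b, c}"
    using face_distinct(1)[OF assms] abc(1) by blast+
  then show ?thesis
    using abc(2-4) by (auto simp: insert_commute)
qed

lemma vangle_cosine_law:
  assumes "dist p q = c" "dist p r = b" "dist q r = a"
  shows "vangle p q r = arccos ((c\<^sup>2 + b\<^sup>2 - a\<^sup>2) / (2 * c * b))"
proof -
  have n: "norm (q - p) = c" "norm (r - p) = b" "norm ((q - p) - (r - p)) = a"
    using assms by (auto simp: dist_norm norm_minus_commute)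
  have "a\<^sup>2 = c\<^sup>2 + b\<^sup>2 - 2 * ((q - p) \<bullet> (r - p))"
    using dot_norm_neg[of "q - p" "r - p"] n by (simp add: field_simps)
  then have "(q - p) \<bullet> (r - p) = (c\<^sup>2 + b\<^sup>2 - a\<^sup>2) / 2"
    by simp
  then show ?thesis
    unfolding vangle_def n by (simp only: divide_divide_eq_left mult.assoc)
qed

lemma triangle_exists:
  fixes a b c :: real
  assumes "a > 0" "b > 0" "c > 0" "a < b + c" "b < a + c" "c < a + b"
  obtains p q r :: complex where "dist p q = c" "dist p r = b" "dist q r = a"
proof -
  define x where "x = (c\<^sup>2 + b\<^sup>2 - a\<^sup>2) / (2 * c)"
  define y where "y = sqrt (b\<^sup>2 - x\<^sup>2)"
  have cx: "2 * c * x = c\<^sup>2 + b\<^sup>2 - a\<^sup>2"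
    using assms by (simp add: x_def)
  have "2 * c * (b - x) = (a + c - b) * (a + b - c)" "2 * c * (b + x) = (b + c - a) * (a + b + c)"
    using cx by (simp_all add: algebra_simps power2_eq_square)
  then have "0 < 2 * c * (b - x)" "0 < 2 * c * (b + x)"
    using assms by simp_all
  then have "0 < b - x" "0 < b + x"
    using assms by (simp_all add: zero_less_mult_iff)
  then have "0 < (b - x) * (b + x)"
    by simp
  then have "0 \<le> b\<^sup>2 - x\<^sup>2"
    by (simp add: algebra_simps power2_eq_square)
  then have y2: "x\<^sup>2 + y\<^sup>2 = b\<^sup>2"
    by (simp add: y_def)
  have "(c - x)\<^sup>2 + y\<^sup>2 = a\<^sup>2"
    using y2 cx by (simp add: power2_eq_square algebra_simps)
  then have "dist (Complex c 0) (Complex x y) = a"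
    using assms by (simp add: dist_norm cmod_def)
  moreover have "dist 0 (Complex c 0) = c" "dist 0 (Complex x y) = b"
    using y2 assms by (simp_all add: cmod_def)
  ultimately show thesis
    using that by blast
qed

lemma inner_angle_cosine_law:
  assumes l: "PL_metric l" and face: "{i, j, k} \<in> F_H"
  shows "inner_angle l i {i, j, k} =
    arccos (((l {i, j})\<^sup>2 + (l {i, k})\<^sup>2 - (l {j, k})\<^sup>2) / (2 * l {i, j} * l {i, k}))"
proof -
  have perms: "{j, i, k} \<in> F_H" "{k, i, j} \<in> F_H" "{i, k, j} \<in> F_H" "{j, k, i} \<in> F_H"
    using face by (simp_all add: insert_commute)
  have pos: "l {i, j} > 0" "l {i, k} > 0" "l {j, k} > 0"
    using l face_edge[OF face] face_edge[OF perms(3)] face_edge[OF perms(4)]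
    by (auto simp: PL_metric_def)
  have "l {b, c} < l {a, b} + l {a, c}" if "{a, b, c} \<in> F_H" for a b c
    using l that by (simp only: PL_metric_def)
  from this[OF face] this[OF perms(1)] this[OF perms(2)]
  have tri: "l {j, k} < l {i, j} + l {i, k}" "l {i, k} < l {i, j} + l {j, k}"
    "l {i, j} < l {i, k} + l {j, k}"
    by (simp_all add: insert_commute)
  obtain p q r :: complex where
    pqr: "dist p q = l {i, j}" "dist p r = l {i, k}" "dist q r = l {j, k}"
    by (rule triangle_exists[of "l {j, k}" "l {i, k}" "l {i, j}"]) (use pos tri in linarith)+
  show ?thesis
    unfolding inner_angle_def
  proof (rule the_equality, goal_cases)
    case 1
    show ?case
      unfolding vangle_cosine_law[OF pqr, symmetric] using pqr by blast
  next
    case (2 \<theta>)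
    then obtain j' k' and p' q' r' :: complex where *: "{i, j, k} = {i, j', k'}"
      "dist p' q' = l {i, j'}" "dist p' r' = l {i, k'}" "dist q' r' = l {j', k'}"
      "\<theta> = vangle p' q' r'"
      by blast
    have "{i, j', k'} \<in> F_H"
      using face *(1) by simp
    note d = face_distinct[OF this]
    have "j' \<in> {i, j, k}" "k' \<in> {i, j, k}"
      unfolding *(1) by simp_all
    then have "j' = j \<and> k' = k \<or> j' = k \<and> k' = j"
      using d by auto
    then show ?case
      unfolding *(5) vangle_cosine_law[OF *(2-4)]
      by (elim disjE conjE) (simp_all add: insert_commute add.commute mult.commute mult.left_commute)
  qed
qed

end

theory Submission imports Defs begin

text \<open>
  The flow is a heat equation in disguise. If the edges \<open>ij\<close> have length
  \<open>exp ((u i + u j) / 2)\<close>, scaling invariance makes the angle of a face at a vertex with value \<open>a\<close>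
  a function of the differences \<open>b - a\<close>, \<open>c - a\<close> to the other two values, and its linearisation
  at the regular metric is \<open>pi / 3 + ((b + c) / 2 - a) / sqrt 3\<close>. Summed over the six faces around
  a vertex this gives a multiple of the graph Laplacian, so near the regular metric
  \<open>u' = - K u\<close> should decrease the \<open>l2\<close> norm and smooth \<open>u\<close> out.

  The nonlinear version of this rests on two facts about one triangle. The excesses of its angles
  over \<open>pi / 3\<close> sum to zero (\<open>excess_sum_zero\<close>), so adding a constant to \<open>u\<close> does not change
  \<open>\<Sum> u i * excess i\<close>; and the excess is strictly differentiable at the regular triangle, so it
  differs from its linearisation by a small multiple of the differences. Together they give
  \<open>\<Sum> u i * excess i \<le> - spread / 10\<close>, with \<open>spread\<close> the sum of the squared differences
  (\<open>energy_dissipation\<close>).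

  To have a flow for all times from the start, the values of \<open>u\<close> are truncated to
  \<open>[- \<delta>, \<delta>]\<close> before the curvature is computed. The resulting vector field is bounded and
  globally Lipschitz for the supremum norm, and Picard iteration solves it
  (\<open>picard_global_solution\<close>). The dissipation inequality survives the truncation. As the supremum
  norm gives no control of \<open>l2\<close> sums, the energy is first localised by a cutoff of
  size \<open>R\<close>: its growth rate is at most a constant times \<open>R\<^sup>-\<^sup>2\<close> times the energy in a slightly larger box. In
  dimension two the box has about \<open>R\<^sup>2\<close> vertices, so boundedness of \<open>u\<close> on \<open>[0, T]\<close> alone shows that
  the energy stays finite; inserting this in the same inequality and letting \<open>R\<close> tend to infinity
  yields the sharp statement (\<open>energy_inequality\<close>) that the energy at time \<open>T\<close> plus a tenth of the integrated
  squared difference along any edge is at most the initial energy. Hence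
  \<open>\<bar>u\<bar>\<close> stays below \<open>\<delta>\<close>, the truncation is invisible, and the truncated flow is the Yamabe flow.

  Convergence: the squared difference along an edge is Lipschitz in time and has
  finite integral, so it tends to zero (\<open>tendsto_0_of_bounded_integral\<close>). If \<open>u\<close> did not tend to zero
  at a vertex, it would be almost equally large at arbitrarily many vertices of the same row,
  contradicting the energy bound (\<open>trunc_tendsto_0\<close>).

  Uniqueness holds among all solutions, without a growth condition, because angles lie between
  \<open>0\<close> and \<open>pi\<close>: every solution moves with speed at most \<open>4 * pi\<close>. A competitor that agrees with
  the small solution at time \<open>T\<close> therefore stays in the region where the curvature is Lipschitz
  for a time that does not depend on \<open>T\<close>, and the two agree on that time span
  (\<open>short_time_uniqueness\<close>).
\<close>

section \<open>The angle of a nearly regular triangle\<close>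

text \<open>
  In a triangle whose vertices carry the values \<open>a, b, c\<close> of \<open>u\<close>, the angle at \<open>a\<close> depends
  only on the two combinations \<open>s = (b + c) / 2 - a\<close> and \<open>d = (b - c) / 2\<close>. In these coordinates
  the law of cosines takes this form; see \<open>cosh_cosine_rule\<close>.
\<close>

definition apex_angle :: "real \<Rightarrow> real \<Rightarrow> real" where
  "apex_angle s d = arccos (cosh d - exp s / 2)"

lemma apex_angle_0: "apex_angle 0 0 = pi / 3"
proof -
  have "arccos (1/2) = pi / 3"
    using arccos_cos[of "pi / 3"] by (simp add: cos_60)
  then show ?thesis by (simp add: apex_angle_def)
qed

text \<open>
  The partial derivatives are continuous, with values \<open>1 / sqrt 3\<close> and \<open>0\<close> at the origin; the
  mean value theorem along a segment does the rest. Strictness (two free points instead of the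
  origin and one free point) makes one estimate serve both as a Lipschitz bound and as a
  linearisation at the regular triangle.
\<close>

lemma apex_angle_strictly_differentiable:
  fixes \<eta> :: real
  assumes "\<eta> > 0"
  obtains \<rho> where "\<rho> > 0"
    "\<And>s d s' d'. \<lbrakk>\<bar>s\<bar> \<le> \<rho>; \<bar>d\<bar> \<le> \<rho>; \<bar>s'\<bar> \<le> \<rho>; \<bar>d'\<bar> \<le> \<rho>\<rbrakk> \<Longrightarrow>
       \<bar>apex_angle s d - apex_angle s' d' - (s - s') / sqrt 3\<bar> \<le> \<eta> * (\<bar>s - s'\<bar> + \<bar>d - d'\<bar>)"
proof -
  define G where "G p = cosh (snd p) - exp (fst p) / 2" for p :: "real \<times> real"
  define Hs where "Hs p = (exp (fst p) / 2) / sqrt (1 - (G p)\<^sup>2)" for p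
  define Hd where "Hd p = - sinh (snd p) / sqrt (1 - (G p)\<^sup>2)" for p
  have G0: "G (0, 0) = 1 / 2" by (simp add: G_def)
  have sq: "sqrt (3 / 4) = sqrt 3 / (2::real)"
    by (simp add: real_sqrt_divide)
  have Hs0: "Hs (0, 0) = 1 / sqrt 3" and Hd0: "Hd (0, 0) = 0"
    using sq by (simp_all add: Hs_def Hd_def G0 power2_eq_square)
  have cG: "isCont G (0, 0)"
    unfolding G_def by (intro continuous_intros) simp
  have cHs: "isCont Hs (0, 0)" and cHd: "isCont Hd (0, 0)"
    unfolding Hs_def Hd_def
    by (intro continuous_intros cG; simp add: G0 power2_eq_square)+
  obtain r1 where r1: "r1 > 0" "\<And>p. dist p (0, 0) < r1 \<Longrightarrow> dist (G p) (G (0, 0)) < 1 / 2"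
    using cG unfolding continuous_at_eps_delta by (metis half_gt_zero zero_less_one)
  obtain r2 where r2: "r2 > 0" "\<And>p. dist p (0, 0) < r2 \<Longrightarrow> dist (Hs p) (Hs (0, 0)) < \<eta>"
    using cHs assms unfolding continuous_at_eps_delta by metis
  obtain r3 where r3: "r3 > 0" "\<And>p. dist p (0, 0) < r3 \<Longrightarrow> dist (Hd p) (Hd (0, 0)) < \<eta>"
    using cHd assms unfolding continuous_at_eps_delta by metis
  define r where "r = min r1 (min r2 r3)"
  have r: "r > 0" using r1(1) r2(1) r3(1) by (simp add: r_def)
  have near: "dist (s, d) (0, 0) < r" if "\<bar>s\<bar> \<le> r / 3" "\<bar>d\<bar> \<le> r / 3" for s d :: real
  proof -
    have "dist (s, d) (0, 0) \<le> \<bar>s\<bar> + \<bar>d\<bar>"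
      by (simp add: dist_Pair_Pair sqrt_sum_squares_le_sum_abs)
    also have "\<dots> \<le> r / 3 + r / 3" using that by linarith
    also have "\<dots> < r" using r by simp
    finally show ?thesis .
  qed
  show thesis
  proof (rule that[of "r / 3"])
    show "r / 3 > 0" using r by simp
    fix s d s' d' :: real
    assume b: "\<bar>s\<bar> \<le> r / 3" "\<bar>d\<bar> \<le> r / 3" "\<bar>s'\<bar> \<le> r / 3" "\<bar>d'\<bar> \<le> r / 3"
    define S where "S t = s' + t * (s - s')" for t :: real
    define E where "E t = d' + t * (d - d')" for t :: real
    \<comment> \<open>The square of radius \<open>r / 3\<close> is convex, so the segment stays inside.\<close>
    have line: "\<bar>x' + t * (x - x')\<bar> \<le> r / 3"
      if "0 \<le> t" "t \<le> 1" "\<bar>x\<bar> \<le> r / 3" "\<bar>x'\<bar> \<le> r / 3" for t x x' :: real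
    proof -
      have "x' + t * (x - x') = (1 - t) *\<^sub>R x' + t *\<^sub>R x" by (simp add: algebra_simps)
      moreover have "(1 - t) *\<^sub>R x' + t *\<^sub>R x \<in> cball 0 (r / 3)"
        by (rule convexD[OF convex_cball]) (use that in auto)
      ultimately show ?thesis by simp
    qed
    have D: "((\<lambda>t. apex_angle (S t) (E t) - t * (s - s') / sqrt 3) has_real_derivative
        (Hs (S t, E t) - 1 / sqrt 3) * (s - s') + Hd (S t, E t) * (d - d')) (at t)"
      and B: "\<bar>Hs (S t, E t) - 1 / sqrt 3\<bar> \<le> \<eta>" "\<bar>Hd (S t, E t)\<bar> \<le> \<eta>"
      if t: "0 \<le> t" "t \<le> 1" for t
    proof -
      have n: "dist (S t, E t) (0, 0) < r"
        unfolding S_def E_def by (intro near line t b)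
      then have "dist (G (S t, E t)) (G (0, 0)) < 1 / 2" using r1(2) by (simp add: r_def)
      then have g: "- 1 < G (S t, E t)" "G (S t, E t) < 1"
        unfolding G0 dist_real_def by linarith+
      show "\<bar>Hs (S t, E t) - 1 / sqrt 3\<bar> \<le> \<eta>" "\<bar>Hd (S t, E t)\<bar> \<le> \<eta>"
        using r2(2)[of "(S t, E t)"] r3(2)[of "(S t, E t)"] n
        by (auto simp: Hs0 Hd0 dist_real_def r_def)
      have "((\<lambda>t. G (S t, E t)) has_real_derivative
          sinh (E t) * (d - d') - exp (S t) / 2 * (s - s')) (at t)"
        unfolding G_def S_def E_def by (auto intro!: derivative_eq_intros)
      note DERIV_chain2[OF DERIV_arccos[OF g] this]
      moreover have "(\<lambda>t. arccos (G (S t, E t))) = (\<lambda>t. apex_angle (S t) (E t))"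
        by (simp add: apex_angle_def G_def)
      ultimately have o: "((\<lambda>t. apex_angle (S t) (E t)) has_real_derivative
          inverse (- sqrt (1 - (G (S t, E t))\<^sup>2)) * (sinh (E t) * (d - d') - exp (S t) / 2 * (s - s'))) (at t)"
        by simp
      show "((\<lambda>t. apex_angle (S t) (E t) - t * (s - s') / sqrt 3) has_real_derivative
        (Hs (S t, E t) - 1 / sqrt 3) * (s - s') + Hd (S t, E t) * (d - d')) (at t)"
      proof (rule DERIV_cong[OF DERIV_diff[OF o]])
        show "((\<lambda>t. t * (s - s') / sqrt 3) has_real_derivative (s - s') / sqrt 3) (at t)"
          using DERIV_cmult_right[OF DERIV_ident, of "(s - s') / sqrt 3"] by simp
        have "inverse (- w) * (h * y - e / 2 * x) - x / k = (e / 2 / w - 1 / k) * x + - h / w * y"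
          for w h y e x k :: real
          by (cases "w = 0"; cases "k = 0"; simp add: field_simps)
        then show "inverse (- sqrt (1 - (G (S t, E t))\<^sup>2)) * (sinh (E t) * (d - d') - exp (S t) / 2 * (s - s'))
            - (s - s') / sqrt 3 = (Hs (S t, E t) - 1 / sqrt 3) * (s - s') + Hd (S t, E t) * (d - d')"
          by (simp only: Hs_def Hd_def fst_conv snd_conv)
      qed
    qed
    obtain z where z: "0 < z" "z < 1"
      and eq: "(apex_angle (S 1) (E 1) - 1 * (s - s') / sqrt 3) - (apex_angle (S 0) (E 0) - 0 * (s - s') / sqrt 3)
        = (1 - 0) * ((Hs (S z, E z) - 1 / sqrt 3) * (s - s') + Hd (S z, E z) * (d - d'))"
      using MVT2[of 0 1, OF _ D] by (metis zero_less_one)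
    have "\<bar>apex_angle s d - apex_angle s' d' - (s - s') / sqrt 3\<bar> =
       \<bar>(Hs (S z, E z) - 1 / sqrt 3) * (s - s') + Hd (S z, E z) * (d - d')\<bar>"
      using eq by (simp add: S_def E_def)
    also have "\<dots> \<le> \<bar>Hs (S z, E z) - 1 / sqrt 3\<bar> * \<bar>s - s'\<bar> + \<bar>Hd (S z, E z)\<bar> * \<bar>d - d'\<bar>"
      by (metis abs_mult abs_triangle_ineq)
    also have "\<dots> \<le> \<eta> * \<bar>s - s'\<bar> + \<eta> * \<bar>d - d'\<bar>"
      using B[of z] z by (intro add_mono mult_right_mono) auto
    finally show "\<bar>apex_angle s d - apex_angle s' d' - (s - s') / sqrt 3\<bar> \<le> \<eta> * (\<bar>s - s'\<bar> + \<bar>d - d'\<bar>)"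
      by (simp add: distrib_left)
  qed
qed

text \<open>
  The hypothesis is the classical identity between the cosines of the angles of a triangle. It
  says \<open>cos (arccos x + arccos y) = - z\<close>, and for acute angles the cosine determines the sum.
\<close>

lemma arccos_sum_pi:
  fixes x y z :: real
  assumes "0 \<le> x" "0 \<le> y" "0 \<le> z" and id: "x\<^sup>2 + y\<^sup>2 + z\<^sup>2 + 2 * x * y * z = 1"
  shows "arccos x + arccos y + arccos z = pi"
proof -
  have nn: "0 \<le> x * y * z" using assms by simp
  have "x\<^sup>2 \<le> 1" "y\<^sup>2 \<le> 1" "z\<^sup>2 \<le> 1"
    using nn id zero_le_power2[of x] zero_le_power2[of y] zero_le_power2[of z] by linarith+
  then have le: "x \<le> 1" "y \<le> 1" "z \<le> 1"
    by (simp_all add: power_le_one_iff abs_le_iff abs_square_le_1)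
  have "(1 - x\<^sup>2) * (1 - y\<^sup>2) = (z + x * y)\<^sup>2"
    using id by (simp add: power2_eq_square algebra_simps)
  then have s: "sqrt (1 - x\<^sup>2) * sqrt (1 - y\<^sup>2) = z + x * y"
    using assms by (simp flip: real_sqrt_mult)
  have cos: "cos (arccos x + arccos y) = cos (pi - arccos z)"
    using le assms s by (simp add: cos_add sin_arccos cos_diff)
  have acute: "arccos x \<le> pi / 2" "arccos y \<le> pi / 2"
    using assms le by (intro arccos_le_pi2; simp)+
  have range: "0 \<le> arccos x" "0 \<le> arccos y" "0 \<le> arccos z" "arccos z \<le> pi"
    using assms le by (auto intro!: arccos_lbound arccos_ubound)
  have "arccos x + arccos y = pi - arccos z"
    by (rule cos_inj_pi[OF _ _ _ _ cos]) (use acute range in linarith)+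
  then show ?thesis by simp
qed

text \<open>
  The cosines \<open>x, y, z\<close> given by the law of cosines for side lengths \<open>p, q, r\<close> satisfy the identity
  that characterises angles with sum \<open>pi\<close>; after multiplication by \<open>4 * (p * q * r)\<^sup>2\<close> it is a
  polynomial identity.
\<close>

lemma cosine_rule_identity:
  fixes p q r x y z :: real
  assumes pos: "p > 0" "q > 0" "r > 0"
    and x: "2 * q * r * x = q\<^sup>2 + r\<^sup>2 - p\<^sup>2"
    and y: "2 * r * p * y = r\<^sup>2 + p\<^sup>2 - q\<^sup>2"
    and z: "2 * p * q * z = p\<^sup>2 + q\<^sup>2 - r\<^sup>2"
  shows "x\<^sup>2 + y\<^sup>2 + z\<^sup>2 + 2 * x * y * z = 1"
proof -
  have "4 * (p * q * r)\<^sup>2 * (x\<^sup>2 + y\<^sup>2 + z\<^sup>2 + 2 * x * y * z) =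
    p\<^sup>2 * (2 * q * r * x)\<^sup>2 + q\<^sup>2 * (2 * r * p * y)\<^sup>2 + r\<^sup>2 * (2 * p * q * z)\<^sup>2
    + (2 * q * r * x) * (2 * r * p * y) * (2 * p * q * z)"
    by (simp add: algebra_simps power2_eq_square)
  also have "\<dots> = 4 * (p * q * r)\<^sup>2 * 1"
    unfolding x y z by (simp add: algebra_simps power2_eq_square)
  finally show ?thesis
    using pos by simp
qed

lemma cosh_cosine_rule:
  fixes a b c :: real
  shows "2 * exp ((a + b) / 2) * exp ((a + c) / 2) * (cosh ((b - c) / 2) - exp ((b + c) / 2 - a) / 2)
    = (exp ((a + b) / 2))\<^sup>2 + (exp ((a + c) / 2))\<^sup>2 - (exp ((b + c) / 2))\<^sup>2"
proof -
  have "exp ((a + b) / 2) * exp ((a + c) / 2) * exp ((b - c) / 2) = (exp ((a + b) / 2))\<^sup>2"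
    "exp ((a + b) / 2) * exp ((a + c) / 2) * exp (- ((b - c) / 2)) = (exp ((a + c) / 2))\<^sup>2"
    "exp ((a + b) / 2) * exp ((a + c) / 2) * exp ((b + c) / 2 - a) = (exp ((b + c) / 2))\<^sup>2"
    by (simp_all add: power2_eq_square add_divide_distrib diff_divide_distrib flip: exp_add)
  then show ?thesis
    by (simp add: cosh_field_def algebra_simps)
qed

text \<open>
  This is the angle sum of a Euclidean triangle; near the regular triangle all angles are acute, so
  \<open>arccos_sum_pi\<close> applies.
\<close>

lemma apex_angle_sum:
  fixes a b c :: real
  assumes "\<bar>a\<bar> \<le> 1/10" "\<bar>b\<bar> \<le> 1/10" "\<bar>c\<bar> \<le> 1/10"
  shows "apex_angle ((b + c) / 2 - a) ((b - c) / 2) + apex_angle ((c + a) / 2 - b) ((c - a) / 2)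
    + apex_angle ((a + b) / 2 - c) ((a - b) / 2) = pi"
proof -
  have nonneg: "0 \<le> cosh ((y - z) / 2) - exp ((y + z) / 2 - x) / 2"
    if "\<bar>x\<bar> \<le> 1/10" "\<bar>y\<bar> \<le> 1/10" "\<bar>z\<bar> \<le> 1/10" for x y z :: real
  proof -
    have "exp ((y + z) / 2 - x) \<le> exp (1 / 2)"
    proof -
      have "y \<le> 1/10" "z \<le> 1/10" "- (1/10) \<le> x" using that by (simp_all add: abs_le_iff)
      then show ?thesis by (simp add: field_simps)
    qed
    also have "exp (1 / 2 :: real) \<le> 2" by (rule exp_half_le2)
    finally show ?thesis using cosh_real_ge_1[of "(y - z) / 2"] by linarith
  qed
  define p q r where "p = exp ((b + c) / 2)" and "q = exp ((c + a) / 2)" and "r = exp ((a + b) / 2)"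
  have pos: "p > 0" "q > 0" "r > 0" by (simp_all add: p_def q_def r_def)
  show ?thesis
    unfolding apex_angle_def
  proof (rule arccos_sum_pi)
    show "(cosh ((b - c) / 2) - exp ((b + c) / 2 - a) / 2)\<^sup>2 +
      (cosh ((c - a) / 2) - exp ((c + a) / 2 - b) / 2)\<^sup>2 +
      (cosh ((a - b) / 2) - exp ((a + b) / 2 - c) / 2)\<^sup>2 +
      2 * (cosh ((b - c) / 2) - exp ((b + c) / 2 - a) / 2) * (cosh ((c - a) / 2) - exp ((c + a) / 2 - b) / 2) *
      (cosh ((a - b) / 2) - exp ((a + b) / 2 - c) / 2) = 1"
    proof (rule cosine_rule_identity[OF pos])
      show "2 * q * r * (cosh ((b - c) / 2) - exp ((b + c) / 2 - a) / 2) = q\<^sup>2 + r\<^sup>2 - p\<^sup>2"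
        using cosh_cosine_rule[of a b c] by (simp add: p_def q_def r_def add.commute ac_simps)
      show "2 * r * p * (cosh ((c - a) / 2) - exp ((c + a) / 2 - b) / 2) = r\<^sup>2 + p\<^sup>2 - q\<^sup>2"
        using cosh_cosine_rule[of b c a] by (simp add: p_def q_def r_def add.commute ac_simps)
      show "2 * p * q * (cosh ((a - b) / 2) - exp ((a + b) / 2 - c) / 2) = p\<^sup>2 + q\<^sup>2 - r\<^sup>2"
        using cosh_cosine_rule[of c a b] by (simp add: p_def q_def r_def add.commute ac_simps)
    qed
  qed (use nonneg assms in auto)
qed

section \<open>Energy dissipation in one triangle\<close>

text \<open>
  The deviation from the angle \<open>pi / 3\<close> at the vertex with value \<open>a\<close>. Since six faces meet
  at each vertex, minus the curvature is the sum of the excesses.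
\<close>

definition excess :: "real \<Rightarrow> real \<Rightarrow> real \<Rightarrow> real" where
  "excess a b c = apex_angle ((b + c) / 2 - a) ((b - c) / 2) - pi / 3"

text \<open>
  The radius \<open>\<delta>\<close> of the region around the regular metric in which angles are almost linear. The error
  factor \<open>1 / 20\<close> is small enough compared with \<open>1 / (2 * sqrt 3)\<close>, the coefficient of the
  dissipation of the linearised flow.
\<close>

locale near_regular =
  fixes \<delta> :: real
  assumes \<delta>_pos: "0 < \<delta>" and \<delta>_le: "\<delta> \<le> 1 / 10"
    and apex_angle_estimate:
      "\<lbrakk>\<bar>s\<bar> \<le> 2 * \<delta>; \<bar>d\<bar> \<le> 2 * \<delta>; \<bar>s'\<bar> \<le> 2 * \<delta>; \<bar>d'\<bar> \<le> 2 * \<delta>\<rbrakk> \<Longrightarrow>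
       \<bar>apex_angle s d - apex_angle s' d' - (s - s') / sqrt 3\<bar> \<le> (\<bar>s - s'\<bar> + \<bar>d - d'\<bar>) / 20"

lemma near_regular_exists: "\<exists>\<delta>. near_regular \<delta>"
proof -
  obtain \<rho> where \<rho>: "\<rho> > 0"
    "\<And>s d s' d'. \<lbrakk>\<bar>s\<bar> \<le> \<rho>; \<bar>d\<bar> \<le> \<rho>; \<bar>s'\<bar> \<le> \<rho>; \<bar>d'\<bar> \<le> \<rho>\<rbrakk> \<Longrightarrow>
       \<bar>apex_angle s d - apex_angle s' d' - (s - s') / sqrt 3\<bar> \<le> 1 / 20 * (\<bar>s - s'\<bar> + \<bar>d - d'\<bar>)"
    by (rule apex_angle_strictly_differentiable[of "1 / 20"]) auto
  have "near_regular (min (1 / 10) (\<rho> / 2))"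
  proof
    show "0 < min (1 / 10) (\<rho> / 2)" "min (1 / 10) (\<rho> / 2) \<le> 1 / 10" using \<rho>(1) by simp_all
    have le: "2 * min (1 / 10) (\<rho> / 2) \<le> \<rho>" by simp
    show "\<bar>apex_angle s d - apex_angle s' d' - (s - s') / sqrt 3\<bar> \<le> (\<bar>s - s'\<bar> + \<bar>d - d'\<bar>) / 20"
      if "\<bar>s\<bar> \<le> 2 * min (1 / 10) (\<rho> / 2)" "\<bar>d\<bar> \<le> 2 * min (1 / 10) (\<rho> / 2)"
        "\<bar>s'\<bar> \<le> 2 * min (1 / 10) (\<rho> / 2)" "\<bar>d'\<bar> \<le> 2 * min (1 / 10) (\<rho> / 2)" for s d s' d'
      using \<rho>(2)[OF that[THEN order_trans[OF _ le]]] by simp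
  qed
  then show ?thesis by blast
qed

lemma inverse_sqrt_3_bounds: "1 / 2 \<le> 1 / sqrt (3::real)" "1 / sqrt (3::real) \<le> 3 / 5"
proof -
  have "sqrt 3 \<le> 2" by (rule real_le_lsqrt) auto
  moreover have "5 / 3 \<le> sqrt 3" by (rule real_le_rsqrt) (simp add: power2_eq_square)
  ultimately show "1 / 2 \<le> 1 / sqrt (3::real)" "1 / sqrt (3::real) \<le> 3 / 5"
    by (simp_all add: field_simps)
qed

lemma abs_divide_sqrt_3_bounds:
  fixes x :: real
  shows "\<bar>x\<bar> / 2 \<le> \<bar>x / sqrt 3\<bar>" "\<bar>x / sqrt 3\<bar> \<le> 3 / 5 * \<bar>x\<bar>"
proof -
  have "\<bar>sqrt 3\<bar> = sqrt (3::real)" by simp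
  then have "\<bar>x / sqrt 3\<bar> = 1 / sqrt 3 * \<bar>x\<bar>"
    by (simp only: abs_divide times_divide_eq_left mult_1_left)
  moreover have "1 / 2 * \<bar>x\<bar> \<le> 1 / sqrt 3 * \<bar>x\<bar>" "1 / sqrt 3 * \<bar>x\<bar> \<le> 3 / 5 * \<bar>x\<bar>"
    by (rule mult_right_mono[OF inverse_sqrt_3_bounds(1)] mult_right_mono[OF inverse_sqrt_3_bounds(2)], simp)+
  ultimately show "\<bar>x\<bar> / 2 \<le> \<bar>x / sqrt 3\<bar>" "\<bar>x / sqrt 3\<bar> \<le> 3 / 5 * \<bar>x\<bar>" by linarith+
qed

context near_regular
begin

lemma excess_estimate:
  assumes "\<bar>a\<bar> \<le> \<delta>" "\<bar>b\<bar> \<le> \<delta>" "\<bar>c\<bar> \<le> \<delta>" "\<bar>a'\<bar> \<le> \<delta>" "\<bar>b'\<bar> \<le> \<delta>" "\<bar>c'\<bar> \<le> \<delta>"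
  shows "\<bar>excess a b c - excess a' b' c' - (((b + c) / 2 - a) - ((b' + c') / 2 - a')) / sqrt 3\<bar>
    \<le> (\<bar>((b + c) / 2 - a) - ((b' + c') / 2 - a')\<bar> + \<bar>(b - c) / 2 - (b' - c') / 2\<bar>) / 20"
proof -
  have "\<bar>(y + z) / 2 - x\<bar> \<le> 2 * \<delta>" "\<bar>(y - z) / 2\<bar> \<le> 2 * \<delta>"
    if "\<bar>x\<bar> \<le> \<delta>" "\<bar>y\<bar> \<le> \<delta>" "\<bar>z\<bar> \<le> \<delta>" for x y z
    unfolding add_divide_distrib diff_divide_distrib using that by linarith+
  from apex_angle_estimate[OF this[OF assms(1-3)] this[OF assms(4-6)]] show ?thesis
    by (simp add: excess_def)
qed

lemma excess_lipschitz:
  assumes "\<bar>a\<bar> \<le> \<delta>" "\<bar>b\<bar> \<le> \<delta>" "\<bar>c\<bar> \<le> \<delta>" "\<bar>a'\<bar> \<le> \<delta>" "\<bar>b'\<bar> \<le> \<delta>" "\<bar>c'\<bar> \<le> \<delta>"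
  shows "\<bar>excess a b c - excess a' b' c'\<bar> \<le> \<bar>a - a'\<bar> + \<bar>b - b'\<bar> + \<bar>c - c'\<bar>"
proof -
  define s where "s = ((b + c) / 2 - a) - ((b' + c') / 2 - a')"
  define d where "d = (b - c) / 2 - (b' - c') / 2"
  have "\<bar>excess a b c - excess a' b' c' - s / sqrt 3\<bar> \<le> (\<bar>s\<bar> + \<bar>d\<bar>) / 20"
    using excess_estimate[OF assms] by (simp add: s_def d_def)
  moreover have "\<bar>s / sqrt 3\<bar> \<le> 3 / 5 * \<bar>s\<bar>"
    by (rule abs_divide_sqrt_3_bounds)
  moreover
  have s_le: "\<bar>y / 2 + z / 2 - x\<bar> \<le> \<bar>x\<bar> + \<bar>y\<bar> / 2 + \<bar>z\<bar> / 2"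
    and d_le: "\<bar>y / 2 - z / 2\<bar> \<le> \<bar>y\<bar> / 2 + \<bar>z\<bar> / 2" for x y z :: real by linarith+
  have "\<bar>s\<bar> \<le> \<bar>a - a'\<bar> + \<bar>b - b'\<bar> / 2 + \<bar>c - c'\<bar> / 2" "\<bar>d\<bar> \<le> \<bar>b - b'\<bar> / 2 + \<bar>c - c'\<bar> / 2"
    using s_le[of "b - b'" "c - c'" "a - a'"] d_le[of "b - b'" "c - c'"]
    by (simp_all add: s_def d_def add_divide_distrib diff_divide_distrib algebra_simps)
  moreover have "\<bar>f\<bar> \<le> \<alpha> + \<beta> + \<gamma>"
    if "\<bar>f - w\<bar> \<le> (\<sigma> + \<tau>) / 20" "\<bar>w\<bar> \<le> 3 / 5 * \<sigma>" "\<sigma> \<le> \<alpha> + \<beta> / 2 + \<gamma> / 2" "\<tau> \<le> \<beta> / 2 + \<gamma> / 2"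
      "0 \<le> \<alpha>" "0 \<le> \<beta>" "0 \<le> \<gamma>"
    for f w \<sigma> \<tau> \<alpha> \<beta> \<gamma> :: real
    using that unfolding add_divide_distrib by linarith
  ultimately show ?thesis using abs_ge_zero by blast
qed

lemma excess_equal [simp]: "excess a a a = 0"
  by (simp add: excess_def apex_angle_0)

lemma excess_linear:
  assumes "\<bar>a\<bar> \<le> \<delta>" "\<bar>b\<bar> \<le> \<delta>" "\<bar>c\<bar> \<le> \<delta>"
  shows "\<bar>excess a b c - ((b + c) / 2 - a) / sqrt 3\<bar> \<le> (\<bar>(b + c) / 2 - a\<bar> + \<bar>(b - c) / 2\<bar>) / 20"
  using excess_estimate[OF assms assms(1) assms(1) assms(1)] by simp

lemma excess_bound:
  assumes "\<bar>a\<bar> \<le> \<delta>" "\<bar>b\<bar> \<le> \<delta>" "\<bar>c\<bar> \<le> \<delta>" and m: "\<bar>b - a\<bar> \<le> m" "\<bar>c - a\<bar> \<le> m"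
  shows "\<bar>excess a b c - ((b + c) / 2 - a) / sqrt 3\<bar> \<le> m / 20" "\<bar>excess a b c\<bar> \<le> m"
proof -
  define s where "s = (b + c) / 2 - a"
  have sm: "\<bar>s\<bar> \<le> m" and "\<bar>s\<bar> + \<bar>(b - c) / 2\<bar> \<le> m"
    unfolding s_def add_divide_distrib diff_divide_distrib using m by linarith+
  then show 1: "\<bar>excess a b c - ((b + c) / 2 - a) / sqrt 3\<bar> \<le> m / 20"
    using excess_linear[OF assms(1-3)] unfolding s_def by (elim order_trans) simp
  have "\<bar>s / sqrt 3\<bar> \<le> 3 / 5 * \<bar>s\<bar>"
    by (rule abs_divide_sqrt_3_bounds)
  then show "\<bar>excess a b c\<bar> \<le> m"
    using 1 sm unfolding s_def[symmetric] by linarith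
qed

lemma excess_sum_zero:
  assumes "\<bar>a\<bar> \<le> \<delta>" "\<bar>b\<bar> \<le> \<delta>" "\<bar>c\<bar> \<le> \<delta>"
  shows "excess a b c + excess b c a + excess c a b = 0"
  using apex_angle_sum[of a b c] assms \<delta>_le by (simp add: excess_def)

text \<open>
  When the value at the vertex is extremal, \<open>b - a\<close> and \<open>c - a\<close> have the same sign, so the error
  is at most a tenth of \<open>\<bar>(b + c) / 2 - a\<bar>\<close> and the linear part decides the sign. This controls the effect
  of the truncation.
\<close>

lemma excess_sign:
  assumes "\<bar>a\<bar> \<le> \<delta>" "\<bar>b\<bar> \<le> \<delta>" "\<bar>c\<bar> \<le> \<delta>"
  shows "\<lbrakk>b \<le> a; c \<le> a\<rbrakk> \<Longrightarrow> excess a b c \<le> 0" "\<lbrakk>a \<le> b; a \<le> c\<rbrakk> \<Longrightarrow> 0 \<le> excess a b c"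
proof -
  define s where "s = (b + c) / 2 - a"
  have e: "\<bar>excess a b c - s / sqrt 3\<bar> \<le> (\<bar>s\<bar> + \<bar>(b - c) / 2\<bar>) / 20"
    unfolding s_def by (rule excess_linear[OF assms])
  have k: "\<bar>s\<bar> / 2 \<le> \<bar>s / sqrt 3\<bar>" by (rule abs_divide_sqrt_3_bounds)
  show "excess a b c \<le> 0" if "b \<le> a" "c \<le> a"
  proof -
    have "s \<le> 0" and ds: "\<bar>(b - c) / 2\<bar> \<le> \<bar>s\<bar>"
      unfolding s_def add_divide_distrib diff_divide_distrib using that by linarith+
    then have "s / sqrt 3 = - \<bar>s / sqrt 3\<bar>"
      by (simp add: divide_nonpos_nonneg abs_of_nonpos del: abs_divide)
    moreover have "x \<le> 0"
      if "w = - W" "x - w \<le> (S + D) / 20" "S / 2 \<le> W" "D \<le> S" "0 \<le> S" for x w W S D :: real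
      using that by simp
    ultimately show ?thesis using abs_le_D1[OF e] k ds abs_ge_zero by blast
  qed
  show "0 \<le> excess a b c" if "a \<le> b" "a \<le> c"
  proof -
    have "0 \<le> s" and ds: "\<bar>(b - c) / 2\<bar> \<le> \<bar>s\<bar>"
      unfolding s_def add_divide_distrib diff_divide_distrib using that by linarith+
    then have "s / sqrt 3 = \<bar>s / sqrt 3\<bar>" by simp
    moreover have "0 \<le> x"
      if "w = W" "- (x - w) \<le> (S + D) / 20" "S / 2 \<le> W" "D \<le> S" "0 \<le> S" for x w W S D :: real
      using that by simp
    ultimately show ?thesis using abs_le_D2[OF e] k ds abs_ge_zero by blast
  qed
qed

definition trunc :: "real \<Rightarrow> real" where
  "trunc x = max (- \<delta>) (min \<delta> x)"

lemma abs_trunc_le: "\<bar>trunc x\<bar> \<le> \<delta>" "\<bar>trunc x\<bar> \<le> \<bar>x\<bar>"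
  and abs_trunc_diff_le: "\<bar>trunc x - trunc y\<bar> \<le> \<bar>x - y\<bar>"
  using \<delta>_pos by (auto simp: trunc_def max_def min_def abs_if)

lemma trunc_id: "\<bar>x\<bar> \<le> \<delta> \<Longrightarrow> trunc x = x"
  by (auto simp: trunc_def abs_le_iff)

definition spread :: "real \<Rightarrow> real \<Rightarrow> real \<Rightarrow> real" where
  "spread a b c = (a - b)\<^sup>2 + (b - c)\<^sup>2 + (c - a)\<^sup>2"

lemma abs_diff_le_sqrt_spread:
  "\<bar>a - b\<bar> \<le> sqrt (spread a b c)" "\<bar>b - c\<bar> \<le> sqrt (spread a b c)" "\<bar>c - a\<bar> \<le> sqrt (spread a b c)"
  by (auto intro!: real_le_rsqrt simp: spread_def)

text \<open>
  For the linearised excess the sum is exactly \<open>- spread / (2 * sqrt 3)\<close>. The three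
  linearisation errors sum to zero, as the excesses and their linear parts do, so
  they pair only with differences of \<open>a, b, c\<close> and contribute at most \<open>spread / 10\<close>.
\<close>

lemma energy_dissipation:
  assumes "\<bar>a\<bar> \<le> \<delta>" "\<bar>b\<bar> \<le> \<delta>" "\<bar>c\<bar> \<le> \<delta>"
  shows "a * excess a b c + b * excess b c a + c * excess c a b \<le> - spread a b c / 10"
proof -
  define k where "k = 1 / sqrt (3::real)"
  define m where "m = sqrt (spread a b c)"
  have sp: "0 \<le> spread a b c" by (simp add: spread_def)
  have mm: "m * m = spread a b c" "0 \<le> m" using sp by (simp_all add: m_def)
  have d: "\<bar>a - b\<bar> \<le> m" "\<bar>b - c\<bar> \<le> m" "\<bar>c - a\<bar> \<le> m"
    unfolding m_def by (rule abs_diff_le_sqrt_spread)+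
  define ea eb ec where "ea = excess a b c - k * ((b + c) / 2 - a)"
    and "eb = excess b c a - k * ((c + a) / 2 - b)" and "ec = excess c a b - k * ((a + b) / 2 - c)"
  have e: "\<bar>ea\<bar> \<le> m / 20" "\<bar>eb\<bar> \<le> m / 20"
    using excess_bound(1)[OF assms(1,2,3), of m] excess_bound(1)[OF assms(2,3,1), of m] d
    by (simp_all add: ea_def eb_def k_def abs_minus_commute)
  have "ea + eb + ec = (excess a b c + excess b c a + excess c a b)
      - k * (((b + c) / 2 - a) + ((c + a) / 2 - b) + ((a + b) / 2 - c))"
    by (simp add: ea_def eb_def ec_def algebra_simps)
  also have "\<dots> = 0"
  proof -
    have "((b + c) / 2 - a) + ((c + a) / 2 - b) + ((a + b) / 2 - c) = 0" by (simp add: field_simps)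
    then show ?thesis by (simp only: excess_sum_zero[OF assms] mult_zero_right diff_self)
  qed
  finally have ec: "ec = - ea - eb" by simp
  have "a * excess a b c + b * excess b c a + c * excess c a b
      = k * (a * ((b + c) / 2 - a) + b * ((c + a) / 2 - b) + c * ((a + b) / 2 - c)) + (a * ea + b * eb + c * ec)"
    by (simp add: ea_def eb_def ec_def algebra_simps)
  also have "a * ((b + c) / 2 - a) + b * ((c + a) / 2 - b) + c * ((a + b) / 2 - c) = - spread a b c / 2"
    by (simp add: spread_def power2_eq_square field_simps)
  also have "a * ea + b * eb + c * ec = (a - c) * ea + (b - c) * eb"
    unfolding ec by (simp add: algebra_simps)
  finally have eq: "a * excess a b c + b * excess b c a + c * excess c a b
      = - (k * spread a b c / 2) + ((a - c) * ea + (b - c) * eb)" by simp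
  have "x * y \<le> m * (m / 20)" if "\<bar>x\<bar> \<le> m" "\<bar>y\<bar> \<le> m / 20" for x y
  proof -
    have "x * y \<le> \<bar>x\<bar> * \<bar>y\<bar>" by (metis abs_ge_self abs_mult)
    also have "\<dots> \<le> m * (m / 20)" using that mm(2) by (intro mult_mono) auto
    finally show ?thesis .
  qed
  from this[of "a - c" ea] this[of "b - c" eb]
  have "(a - c) * ea \<le> m * (m / 20)" "(b - c) * eb \<le> m * (m / 20)"
    using d e by (simp_all add: abs_minus_commute)
  moreover have "1 / 2 * spread a b c \<le> k * spread a b c"
    using inverse_sqrt_3_bounds(1) sp unfolding k_def by (intro mult_right_mono)
  moreover have "m * (m / 20) = spread a b c / 20" using mm(1) by simp
  ultimately show ?thesis unfolding eq using sp by linarith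
qed

text \<open>
  Replacing the outer factors by the untruncated values only helps: where \<open>A\<close> exceeds \<open>\<delta>\<close>, the
  truncated value is maximal among the three and its excess is nonpositive.
\<close>

lemma truncated_energy_dissipation:
  assumes "a = trunc A" "b = trunc B" "c = trunc C"
  shows "A * excess a b c + B * excess b c a + C * excess c a b \<le> - spread a b c / 10"
proof -
  have tail: "(X - trunc X) * excess (trunc X) (trunc Y) (trunc Z) \<le> 0" for X Y Z
  proof -
    have b: "- \<delta> \<le> trunc Y" "trunc Y \<le> \<delta>" "- \<delta> \<le> trunc Z" "trunc Z \<le> \<delta>"
      using abs_trunc_le(1)[of Y] abs_trunc_le(1)[of Z] by (simp_all add: abs_le_iff)
    consider "\<bar>X\<bar> \<le> \<delta>" | "X > \<delta>" | "X < - \<delta>" by linarith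
    then show ?thesis
    proof cases
      case 1
      then show ?thesis by (simp add: trunc_id)
    next
      case 2
      then have t: "trunc X = \<delta>" using \<delta>_pos by (simp add: trunc_def)
      have "excess (trunc X) (trunc Y) (trunc Z) \<le> 0"
        by (intro excess_sign(1) abs_trunc_le) (use b t in auto)
      with 2 t show ?thesis by (intro mult_nonneg_nonpos) auto
    next
      case 3
      then have t: "trunc X = - \<delta>" using \<delta>_pos by (simp add: trunc_def)
      have "excess (trunc X) (trunc Y) (trunc Z) \<ge> 0"
        by (intro excess_sign(2) abs_trunc_le) (use b t in auto)
      with 3 t show ?thesis by (intro mult_nonpos_nonneg) auto
    qed
  qed
  show ?thesis
    using tail[of A B C] tail[of B C A] tail[of C A B] energy_dissipation[of a b c]
    by (simp add: assms abs_trunc_le algebra_simps)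
qed

text \<open>
  Weights \<open>p, q, r\<close> that vary by at most \<open>\<kappa>\<close> cost, by the inequality between arithmetic and
  geometric means, half of the dissipation and a term of order \<open>\<kappa>\<^sup>2\<close>. The quadratic order in \<open>\<kappa>\<close>
  is what makes the cutoff work in dimension two.
\<close>

lemma weighted_energy_dissipation:
  assumes abc: "a = trunc A" "b = trunc B" "c = trunc C"
    and "0 \<le> p" "0 \<le> q" "0 \<le> r" "\<bar>q - p\<bar> \<le> \<kappa>" "\<bar>r - p\<bar> \<le> \<kappa>"
  shows "p\<^sup>2 * A * excess a b c + q\<^sup>2 * B * excess b c a + r\<^sup>2 * C * excess c a b
    \<le> - (p\<^sup>2 * spread a b c / 20) + 44 * \<kappa>\<^sup>2 * (A\<^sup>2 + B\<^sup>2 + C\<^sup>2)"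
proof -
  define m where "m = sqrt (spread a b c)"
  have sp: "0 \<le> spread a b c" by (simp add: spread_def)
  have mm: "m\<^sup>2 = spread a b c" "0 \<le> m" using sp by (simp_all add: m_def)
  have d: "\<bar>a - b\<bar> \<le> m" "\<bar>b - c\<bar> \<le> m" "\<bar>c - a\<bar> \<le> m"
    unfolding m_def by (rule abs_diff_le_sqrt_spread)+
  have err: "(w\<^sup>2 - p\<^sup>2) * X * f \<le> p\<^sup>2 * m\<^sup>2 / 40 + 41 * \<kappa>\<^sup>2 * X\<^sup>2 + \<kappa>\<^sup>2 * m\<^sup>2 / 2"
    if w: "0 \<le> w" "\<bar>w - p\<bar> \<le> \<kappa>" and f: "\<bar>f\<bar> \<le> m" for w X f
  proof -
    have "\<bar>w\<^sup>2 - p\<^sup>2\<bar> = \<bar>w - p\<bar> * \<bar>w + p\<bar>"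
      by (simp add: power2_eq_square algebra_simps flip: abs_mult)
    also have "\<dots> \<le> \<kappa> * (2 * p + \<kappa>)"
      using w \<open>0 \<le> p\<close> by (intro mult_mono) auto
    finally have 1: "\<bar>w\<^sup>2 - p\<^sup>2\<bar> \<le> \<kappa> * (2 * p + \<kappa>)" .
    have "(w\<^sup>2 - p\<^sup>2) * X * f \<le> \<bar>w\<^sup>2 - p\<^sup>2\<bar> * \<bar>X\<bar> * \<bar>f\<bar>"
      by (metis abs_ge_self abs_mult)
    also have "\<dots> \<le> \<kappa> * (2 * p + \<kappa>) * \<bar>X\<bar> * m"
      using 1 f mm(2) w \<open>0 \<le> p\<close> by (intro mult_mono mult_nonneg_nonneg) auto
    also have "\<dots> = 2 * (p * m) * (\<kappa> * \<bar>X\<bar>) + \<kappa>\<^sup>2 * (\<bar>X\<bar> * m)"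
      by (simp add: power2_eq_square algebra_simps)
    also have "2 * (p * m) * (\<kappa> * \<bar>X\<bar>) \<le> (p * m)\<^sup>2 / 40 + 40 * (\<kappa> * \<bar>X\<bar>)\<^sup>2"
    proof -
      have "2 * x * y \<le> x\<^sup>2 / 40 + 40 * y\<^sup>2" for x y :: real
        using zero_le_power2[of "x / 40 - y"] by (simp add: power2_eq_square field_simps)
      then show ?thesis .
    qed
    also have "\<kappa>\<^sup>2 * (\<bar>X\<bar> * m) \<le> \<kappa>\<^sup>2 * ((X\<^sup>2 + m\<^sup>2) / 2)"
      using zero_le_power2[of "\<bar>X\<bar> - m"]
      by (intro mult_left_mono) (simp_all add: power2_eq_square field_simps)
    also have "(p * m)\<^sup>2 / 40 + 40 * (\<kappa> * \<bar>X\<bar>)\<^sup>2 + \<kappa>\<^sup>2 * ((X\<^sup>2 + m\<^sup>2) / 2)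
       \<le> p\<^sup>2 * m\<^sup>2 / 40 + 41 * \<kappa>\<^sup>2 * X\<^sup>2 + \<kappa>\<^sup>2 * m\<^sup>2 / 2"
      by (simp add: power_mult_distrib field_simps)
    finally show ?thesis by simp
  qed
  have "spread a b c \<le> 3 * (a\<^sup>2 + b\<^sup>2 + c\<^sup>2)"
    using zero_le_power2[of "a + b + c"] by (simp add: spread_def power2_eq_square algebra_simps)
  also have "\<dots> \<le> 3 * (A\<^sup>2 + B\<^sup>2 + C\<^sup>2)"
    using abs_trunc_le(2)[of A] abs_trunc_le(2)[of B] abs_trunc_le(2)[of C]
    by (intro mult_left_mono add_mono) (simp_all add: abc abs_le_square_iff)
  finally have spr: "\<kappa>\<^sup>2 * m\<^sup>2 \<le> \<kappa>\<^sup>2 * (3 * (A\<^sup>2 + B\<^sup>2 + C\<^sup>2))"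
    unfolding mm(1) by (rule mult_left_mono) simp
  have main: "p\<^sup>2 * (A * excess a b c + B * excess b c a + C * excess c a b) \<le> p\<^sup>2 * (- spread a b c / 10)"
    using truncated_energy_dissipation[OF abc] by (rule mult_left_mono) simp
  have fb: "\<bar>excess b c a\<bar> \<le> m" "\<bar>excess c a b\<bar> \<le> m"
    using d by (auto intro!: excess_bound(2) simp: abc abs_trunc_le abs_minus_commute)
  have "p\<^sup>2 * A * excess a b c + q\<^sup>2 * B * excess b c a + r\<^sup>2 * C * excess c a b
     = p\<^sup>2 * (A * excess a b c + B * excess b c a + C * excess c a b)
       + (q\<^sup>2 - p\<^sup>2) * B * excess b c a + (r\<^sup>2 - p\<^sup>2) * C * excess c a b"
    by (simp add: algebra_simps)
  also have "\<dots> \<le> p\<^sup>2 * (- spread a b c / 10) + (p\<^sup>2 * m\<^sup>2 / 40 + 41 * \<kappa>\<^sup>2 * B\<^sup>2 + \<kappa>\<^sup>2 * m\<^sup>2 / 2)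
      + (p\<^sup>2 * m\<^sup>2 / 40 + 41 * \<kappa>\<^sup>2 * C\<^sup>2 + \<kappa>\<^sup>2 * m\<^sup>2 / 2)"
    by (intro add_mono main err fb assms)
  also have "\<dots> = - (p\<^sup>2 * spread a b c / 20) + 41 * \<kappa>\<^sup>2 * (B\<^sup>2 + C\<^sup>2) + \<kappa>\<^sup>2 * m\<^sup>2"
    by (simp add: mm(1) field_simps)
  also have "\<dots> \<le> - (p\<^sup>2 * spread a b c / 20) + 41 * \<kappa>\<^sup>2 * (A\<^sup>2 + B\<^sup>2 + C\<^sup>2) + \<kappa>\<^sup>2 * (3 * (A\<^sup>2 + B\<^sup>2 + C\<^sup>2))"
    by (intro add_mono spr mult_left_mono order_refl) auto
  finally show ?thesis by (simp add: algebra_simps)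
qed

end

section \<open>Curvature on the triangular lattice\<close>

definition up_face :: "int \<Rightarrow> int \<Rightarrow> vertex set" where
  "up_face m n = {(m, n), (m + 1, n), (m, n + 1)}"

definition down_face :: "int \<Rightarrow> int \<Rightarrow> vertex set" where
  "down_face m n = {(m + 1, n), (m, n + 1), (m + 1, n + 1)}"

lemma in_F_H_iff: "\<Delta> \<in> F_H \<longleftrightarrow> (\<exists>m n. \<Delta> = up_face m n \<or> \<Delta> = down_face m n)"
  by (auto simp: F_H_def up_face_def down_face_def)

abbreviation faces_at :: "vertex \<Rightarrow> vertex set set" where
  "faces_at i \<equiv> {\<Delta>. \<Delta> \<in> F_H \<and> i \<in> \<Delta>}"

lemma faces_at_eq:
  "faces_at (m, n) = {up_face m n, up_face (m - 1) n, up_face m (n - 1),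
     down_face (m - 1) n, down_face m (n - 1), down_face (m - 1) (n - 1)}"
  (is "_ = ?S")
proof
  show "faces_at (m, n) \<subseteq> ?S"
  proof
    fix \<Delta> assume "\<Delta> \<in> faces_at (m, n)"
    then obtain a b where ab: "\<Delta> = up_face a b \<or> \<Delta> = down_face a b" and i: "(m, n) \<in> \<Delta>"
      by (auto simp: in_F_H_iff)
    from ab show "\<Delta> \<in> ?S"
    proof
      assume *: "\<Delta> = up_face a b"
      then have "(a, b) \<in> {(m, n), (m - 1, n), (m, n - 1)}" using i by (auto simp: up_face_def)
      then show ?thesis using * by auto
    next
      assume *: "\<Delta> = down_face a b"
      then have "(a, b) \<in> {(m - 1, n), (m, n - 1), (m - 1, n - 1)}" using i by (auto simp: down_face_def)
      then show ?thesis using * by auto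
    qed
  qed
  show "?S \<subseteq> faces_at (m, n)"
  proof -
    have "up_face a b \<in> F_H" "down_face a b \<in> F_H" for a b by (auto simp: in_F_H_iff)
    moreover have "(m, n) \<in> up_face a b \<longleftrightarrow> (m, n) \<in> {(a, b), (a + 1, b), (a, b + 1)}"
      "(m, n) \<in> down_face a b \<longleftrightarrow> (m, n) \<in> {(a + 1, b), (a, b + 1), (a + 1, b + 1)}" for a b
      by (simp_all only: up_face_def down_face_def)
    ultimately show ?thesis by auto
  qed
qed

lemma finite_faces_at [simp]: "finite (faces_at i)"
  by (cases i) (simp only: faces_at_eq finite_insert finite.emptyI)

text \<open>
  The coordinate sums of the vertices tell the six faces around a vertex apart.
\<close>

lemma card_faces_at: "card (faces_at i) = 6"
proof -
  obtain m n where i: "i = (m, n)" by (cases i)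
  define cen where "cen \<Delta> = (sum fst \<Delta>, sum snd \<Delta>)" for \<Delta> :: "vertex set"
  have cen: "cen (up_face a b) = (3 * a + 1, 3 * b + 1)" "cen (down_face a b) = (3 * a + 2, 3 * b + 2)" for a b
    by (simp_all add: cen_def up_face_def down_face_def)
  have "card (cen ` faces_at i) = 6"
    unfolding i faces_at_eq image_insert image_empty cen by simp
  then have "6 \<le> card (faces_at i)"
    using card_image_le[of "faces_at i" cen] by simp
  moreover have "card (faces_at i) \<le> 6"
  proof -
    have "faces_at i = set [up_face m n, up_face (m - 1) n, up_face m (n - 1),
        down_face (m - 1) n, down_face m (n - 1), down_face (m - 1) (n - 1)]"
      unfolding i faces_at_eq by (simp only: list.set)
    then have "card (faces_at i) \<le> length [up_face m n, up_face (m - 1) n, up_face m (n - 1),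
        down_face (m - 1) n, down_face m (n - 1), down_face (m - 1) (n - 1)]"
      by (simp only: card_length)
    then show ?thesis by simp
  qed
  ultimately show ?thesis by simp
qed

lemma face_cases:
  assumes "\<Delta> \<in> F_H" "i \<in> \<Delta>"
  obtains j k where "\<Delta> = {i, j, k}"
  using assms by (auto simp: in_F_H_iff up_face_def down_face_def)

lemma sum_face:
  fixes g :: "vertex \<Rightarrow> 'a :: comm_monoid_add"
  assumes "{i, j, k} \<in> F_H"
  shows "sum g {i, j, k} = g i + (g j + g k)"
  using face_distinct[OF assms] by simp

lemma face_neighbours:
  assumes "\<Delta> \<in> F_H" "i \<in> \<Delta>" "j \<in> \<Delta>"
  shows "\<bar>fst i - fst j\<bar> \<le> 1" "\<bar>snd i - snd j\<bar> \<le> 1"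
  using assms by (auto simp: in_F_H_iff up_face_def down_face_def)

lemma inner_angle_bounds:
  assumes l: "PL_metric l" and face: "\<Delta> \<in> F_H" "i \<in> \<Delta>"
  shows "0 \<le> inner_angle l i \<Delta>" "inner_angle l i \<Delta> \<le> pi"
proof -
  obtain j k where jk: "\<Delta> = {i, j, k}" using face_cases[OF face] .
  have f: "{i, j, k} \<in> F_H" using face jk by simp
  have perms: "{j, i, k} \<in> F_H" "{k, i, j} \<in> F_H" "{i, k, j} \<in> F_H" "{j, k, i} \<in> F_H"
    using f by (simp_all add: insert_commute)
  define c b a where "c = l {i, j}" and "b = l {i, k}" and "a = l {j, k}"
  have pos: "c > 0" "b > 0"
    using l face_edge[OF f] face_edge[OF perms(3)] by (auto simp: PL_metric_def c_def b_def)
  have "l {y, z} < l {x, y} + l {x, z}" if "{x, y, z} \<in> F_H" for x y z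
    using l that by (simp only: PL_metric_def)
  from this[OF f] this[OF perms(1)] this[OF perms(2)]
  have tri: "a < c + b" "b < c + a" "c < b + a"
    by (simp_all add: insert_commute a_def b_def c_def)
  have "(c - b)\<^sup>2 \<le> a\<^sup>2" "a\<^sup>2 \<le> (c + b)\<^sup>2"
    using tri pos by (auto intro!: power2_le_iff_abs_le[THEN iffD2] simp flip: abs_le_square_iff)
  then have "- (2 * c * b) \<le> c\<^sup>2 + b\<^sup>2 - a\<^sup>2" "c\<^sup>2 + b\<^sup>2 - a\<^sup>2 \<le> 2 * c * b"
    by (simp_all add: power2_eq_square algebra_simps)
  then have "- 1 \<le> (c\<^sup>2 + b\<^sup>2 - a\<^sup>2) / (2 * c * b)" "(c\<^sup>2 + b\<^sup>2 - a\<^sup>2) / (2 * c * b) \<le> 1"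
    using pos by (simp_all add: divide_simps)
  then show "0 \<le> inner_angle l i \<Delta>" "inner_angle l i \<Delta> \<le> pi"
    unfolding jk inner_angle_cosine_law[OF l f] c_def b_def a_def
    by (auto intro!: arccos_lbound arccos_ubound)
qed

text \<open>
  The six angles at a vertex lie in \<open>[0, pi]\<close>. This bound holds for every PL metric, near the
  regular one or not, and gives all solutions of the flow a bounded speed.
\<close>

lemma abs_curvature_le:
  assumes "PL_metric (u \<^bold>* d_reg)"
  shows "\<bar>curvature u i\<bar> \<le> 4 * pi"
proof -
  have "0 \<le> (\<Sum>\<Delta>\<in>faces_at i. inner_angle (u \<^bold>* d_reg) i \<Delta>)"
    by (intro sum_nonneg inner_angle_bounds assms) auto
  moreover have "(\<Sum>\<Delta>\<in>faces_at i. inner_angle (u \<^bold>* d_reg) i \<Delta>) \<le> of_nat (card (faces_at i)) * pi"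
    by (intro sum_bounded_above inner_angle_bounds assms) auto
  ultimately show ?thesis
    unfolding curvature_def card_faces_at using pi_gt_zero by simp
qed

context near_regular
begin

lemma PL_metric_near_regular:
  assumes u: "\<And>i. \<bar>u i\<bar> \<le> \<delta>"
  shows "PL_metric (u \<^bold>* d_reg)"
  unfolding PL_metric_def
proof safe
  show "0 < (u \<^bold>* d_reg) e" for e
    by (simp add: conformal_def d_reg_def)
  fix i j k assume f: "{i, j, k} \<in> F_H"
  have "exp ((u j + u k) / 2) \<le> exp (1 / 10)"
    using u[of j] u[of k] \<delta>_le by (simp add: abs_le_iff)
  also have "exp (1 / 10 :: real) < 2 * exp (- 1 / 10)"
  proof -
    have "exp (1 / 10) * exp (1 / 10) < exp (1 / 2 :: real)" by (simp flip: exp_add)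
    also have "\<dots> \<le> 2" by (rule exp_half_le2)
    finally show ?thesis by (simp add: exp_minus field_simps)
  qed
  also have "2 * exp (- 1 / 10) \<le> exp ((u i + u j) / 2) + exp ((u i + u k) / 2)"
  proof -
    have "exp (- 1 / 10) \<le> exp ((u i + u j) / 2)" "exp (- 1 / 10) \<le> exp ((u i + u k) / 2)"
      using u[of i] u[of j] u[of k] \<delta>_le by (simp_all add: abs_le_iff)
    then show ?thesis by linarith
  qed
  finally show "(u \<^bold>* d_reg) {j, k} < (u \<^bold>* d_reg) {i, j} + (u \<^bold>* d_reg) {i, k}"
    using face_distinct[OF f] by (simp add: conformal_edge)
qed

lemma inner_angle_excess:
  assumes u: "\<And>i. \<bar>u i\<bar> \<le> \<delta>" and f: "{i, j, k} \<in> F_H"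
  shows "inner_angle (u \<^bold>* d_reg) i {i, j, k} = pi / 3 + excess (u i) (u j) (u k)"
proof -
  define c b a where "c = exp ((u i + u j) / 2)" and "b = exp ((u i + u k) / 2)" and "a = exp ((u j + u k) / 2)"
  have "2 * c * b * (cosh ((u j - u k) / 2) - exp ((u j + u k) / 2 - u i) / 2) = c\<^sup>2 + b\<^sup>2 - a\<^sup>2"
    unfolding c_def b_def a_def by (rule cosh_cosine_rule)
  moreover have "2 * c * b \<noteq> 0" by (simp add: c_def b_def)
  ultimately have "(c\<^sup>2 + b\<^sup>2 - a\<^sup>2) / (2 * c * b) = cosh ((u j - u k) / 2) - exp ((u j + u k) / 2 - u i) / 2"
    by (metis nonzero_mult_div_cancel_left)
  then show ?thesis
    unfolding inner_angle_cosine_law[OF PL_metric_near_regular[OF u] f] excess_def apex_angle_def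
    using face_distinct[OF f] by (simp add: conformal_edge c_def b_def a_def)
qed

definition face_excess :: "(vertex \<Rightarrow> real) \<Rightarrow> vertex \<Rightarrow> vertex set \<Rightarrow> real" where
  "face_excess u i \<Delta> = inner_angle (u \<^bold>* d_reg) i \<Delta> - pi / 3"

lemma face_excess_eq:
  assumes "\<And>i. \<bar>u i\<bar> \<le> \<delta>" "{i, j, k} \<in> F_H"
  shows "face_excess u i {i, j, k} = excess (u i) (u j) (u k)"
  by (simp add: face_excess_def inner_angle_excess assms)

lemma curvature_eq: "- curvature u i = (\<Sum>\<Delta>\<in>faces_at i. face_excess u i \<Delta>)"
proof -
  have "(\<Sum>\<Delta>\<in>faces_at i. face_excess u i \<Delta>)
      = (\<Sum>\<Delta>\<in>faces_at i. inner_angle (u \<^bold>* d_reg) i \<Delta>) - of_nat (card (faces_at i)) * (pi / 3)"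
    by (simp only: face_excess_def sum_subtractf sum_constant)
  then show ?thesis by (simp add: card_faces_at curvature_def)
qed

lemma curvature_lipschitz:
  assumes u: "\<And>i. \<bar>u i\<bar> \<le> \<delta>" and v: "\<And>i. \<bar>v i\<bar> \<le> \<delta>"
  shows "\<bar>curvature u i - curvature v i\<bar> \<le> (\<Sum>\<Delta>\<in>faces_at i. \<Sum>j\<in>\<Delta>. \<bar>u j - v j\<bar>)"
proof -
  have "\<bar>curvature u i - curvature v i\<bar> = \<bar>(\<Sum>\<Delta>\<in>faces_at i. face_excess u i \<Delta> - face_excess v i \<Delta>)\<bar>"
    by (simp add: sum_subtractf abs_minus_commute flip: curvature_eq)
  also have "\<dots> \<le> (\<Sum>\<Delta>\<in>faces_at i. \<bar>face_excess u i \<Delta> - face_excess v i \<Delta>\<bar>)"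
    by (rule sum_abs)
  also have "\<dots> \<le> (\<Sum>\<Delta>\<in>faces_at i. \<Sum>j\<in>\<Delta>. \<bar>u j - v j\<bar>)"
  proof (rule sum_mono)
    fix \<Delta> assume "\<Delta> \<in> faces_at i"
    then have \<Delta>: "\<Delta> \<in> F_H" "i \<in> \<Delta>" by auto
    obtain j k where jk: "\<Delta> = {i, j, k}" using face_cases[OF \<Delta>] .
    have f: "{i, j, k} \<in> F_H" using \<Delta> jk by simp
    show "\<bar>face_excess u i \<Delta> - face_excess v i \<Delta>\<bar> \<le> (\<Sum>j\<in>\<Delta>. \<bar>u j - v j\<bar>)"
      unfolding jk sum_face[OF f] face_excess_eq[OF u f] face_excess_eq[OF v f]
      using excess_lipschitz[OF u[of i] u[of j] u[of k] v[of i] v[of j] v[of k]] by simp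
  qed
  finally show ?thesis .
qed

lemma curvature_lipschitz_sup:
  assumes "\<And>i. \<bar>u i\<bar> \<le> \<delta>" "\<And>i. \<bar>v i\<bar> \<le> \<delta>" and B: "\<And>j. \<bar>u j - v j\<bar> \<le> B"
  shows "\<bar>curvature u i - curvature v i\<bar> \<le> 18 * B"
proof -
  have "(\<Sum>\<Delta>\<in>faces_at i. \<Sum>j\<in>\<Delta>. \<bar>u j - v j\<bar>) \<le> of_nat (card (faces_at i)) * (3 * B)"
  proof (rule sum_bounded_above)
    fix \<Delta> assume "\<Delta> \<in> faces_at i"
    then have \<Delta>: "\<Delta> \<in> F_H" "i \<in> \<Delta>" by auto
    obtain j k where jk: "\<Delta> = {i, j, k}" using face_cases[OF \<Delta>] .
    show "(\<Sum>j\<in>\<Delta>. \<bar>u j - v j\<bar>) \<le> 3 * B"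
      using sum_face[where g = "\<lambda>j. \<bar>u j - v j\<bar>" and i = i and j = j and k = k] \<Delta> jk B[of i] B[of j] B[of k] by simp
  qed
  then show ?thesis
    using curvature_lipschitz[of u v i, OF assms(1,2)] unfolding card_faces_at by simp
qed

lemma continuous_on_curvature:
  assumes x: "\<And>s i. \<bar>x s i\<bar> \<le> \<delta>" and c: "\<And>j. continuous_on S (\<lambda>s. x s j)"
  shows "continuous_on S (\<lambda>s. curvature (x s) i)"
  unfolding continuous_on_def
proof
  fix t assume t: "t \<in> S"
  have "((\<lambda>s. \<Sum>\<Delta>\<in>faces_at i. \<Sum>j\<in>\<Delta>. \<bar>x s j - x t j\<bar>) \<longlongrightarrow>
      (\<Sum>\<Delta>\<in>faces_at i. \<Sum>j\<in>\<Delta>. \<bar>x t j - x t j\<bar>)) (at t within S)"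
    by (intro tendsto_intros) (use c t in \<open>auto simp: continuous_on_def\<close>)
  then have "((\<lambda>s. \<Sum>\<Delta>\<in>faces_at i. \<Sum>j\<in>\<Delta>. \<bar>x s j - x t j\<bar>) \<longlongrightarrow> 0) (at t within S)"
    by simp
  then have "((\<lambda>s. curvature (x s) i - curvature (x t) i) \<longlongrightarrow> 0) (at t within S)"
    by (rule Lim_null_comparison[rotated]) (simp add: curvature_lipschitz x)
  then show "((\<lambda>s. curvature (x s) i) \<longlongrightarrow> curvature (x t) i) (at t within S)"
    by (rule LIM_zero_cancel)
qed

end

section \<open>Ordinary differential equations and inequalities on the half-line\<close>

lemma has_real_derivative_integral_0:
  fixes g :: "real \<Rightarrow> real"
  assumes g: "continuous_on {0..} g" and t: "0 \<le> t"
  shows "((\<lambda>t. integral {0..t} g) has_real_derivative g t) (at t within {0..})"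
proof -
  have "continuous_on {0..t + 1} g" by (rule continuous_on_subset[OF g]) auto
  then have "((\<lambda>t. integral {0..t} g) has_real_derivative g t) (at t within {0..t + 1})"
    by (rule integral_has_real_derivative) (use t in auto)
  moreover have "at t within {0..t + 1} = at t within {0..}"
    by (rule at_within_nhd[of _ "{..<t + 1}"]) (use t in auto)
  ultimately show ?thesis by simp
qed

text \<open>
  The exponential weight \<open>exp (2 * L * t)\<close> makes the Picard map a contraction with factor
  \<open>1 / 2\<close> on the whole half-line, so no continuation argument is needed. The coordinates of \<open>x s\<close>
  are continuous in \<open>s\<close> one at a time, not uniformly, so the integrals only make sense because of the
  separate continuity assumption \<open>cont\<close>; it holds when each coordinate of \<open>F\<close> depends on finitely many
  coordinates.
\<close>

lemma picard_global_solution: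
  fixes F :: "('i \<Rightarrow> real) \<Rightarrow> 'i \<Rightarrow> real" and \<phi> :: "'i \<Rightarrow> real"
  assumes L: "L > 0"
    and Lip: "\<And>x y i B. (\<And>j. \<bar>x j - y j\<bar> \<le> B) \<Longrightarrow> \<bar>F x i - F y i\<bar> \<le> L * B"
    and cont: "\<And>(x :: real \<Rightarrow> 'i \<Rightarrow> real) i. (\<And>j. continuous_on {0..} (\<lambda>s. x s j)) \<Longrightarrow> continuous_on {0..} (\<lambda>s. F (x s) i)"
    and bdd: "\<And>i. \<bar>F \<phi> i\<bar> \<le> M"
  obtains x :: "real \<Rightarrow> 'i \<Rightarrow> real"
  where "\<And>i. x 0 i = \<phi> i"
    "\<And>t i. t \<ge> 0 \<Longrightarrow> ((\<lambda>s. x s i) has_real_derivative F (x t) i) (at t within {0..})"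
proof -
  define X :: "nat \<Rightarrow> real \<Rightarrow> 'i \<Rightarrow> real" where "X = rec_nat (\<lambda>t. \<phi>) (\<lambda>n x t i. \<phi> i + integral {0..t} (\<lambda>s. F (x s) i))"
  have X0: "X 0 t = \<phi>" for t by (simp add: X_def)
  have XS: "X (Suc n) t i = \<phi> i + integral {0..t} (\<lambda>s. F (X n s) i)" for n t i
    by (simp add: X_def)
  have Xc: "continuous_on {0..} (\<lambda>s. X n s i)" for n and i :: 'i
  proof (induction n arbitrary: i)
    case 0
    show ?case by (simp add: X0)
  next
    case (Suc n)
    have "((\<lambda>t. \<phi> i + integral {0..t} (\<lambda>s. F (X n s) i)) has_real_derivative F (X n t) i) (at t within {0..})"
      if "t \<ge> 0" for t
      using has_real_derivative_integral_0[OF cont[of "X n" i] that] Suc.IH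
      by (auto intro!: derivative_eq_intros)
    then show ?case unfolding XS
      by (intro DERIV_continuous_on) auto
  qed
  have int: "(\<lambda>s. F (x s) i) integrable_on {0..t}" if "\<And>j. continuous_on {0..} (\<lambda>s. x s j)"
    for x :: "real \<Rightarrow> 'i \<Rightarrow> real" and i t
    by (rule integrable_continuous_real, rule continuous_on_subset[OF cont]) (use that in auto)
  have exp_int: "((\<lambda>s. K * exp (2 * L * s)) has_integral K * (exp (2 * L * t) - 1) / (2 * L)) {0..t}"
    if "0 \<le> t" for K t :: real
  proof -
    have "((\<lambda>s. K * exp (2 * L * s)) has_integral
        K * exp (2 * L * t) / (2 * L) - K * exp (2 * L * 0) / (2 * L)) {0..t}"
      using that L by (intro fundamental_theorem_of_calculus)
        (auto intro!: derivative_eq_intros simp flip: has_real_derivative_iff_has_vector_derivative)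
    then show ?thesis by (simp add: right_diff_distrib diff_divide_distrib)
  qed
  have step: "\<bar>integral {0..t} (\<lambda>s. F (x s) i) - integral {0..t} (\<lambda>s. F (y s) i)\<bar> \<le> K / 2 * exp (2 * L * t)"
    if t: "0 \<le> t" and x: "\<And>j. continuous_on {0..} (\<lambda>s. x s j)" and y: "\<And>j. continuous_on {0..} (\<lambda>s. y s j)"
      and K: "K \<ge> 0" and d: "\<And>s j. s \<ge> 0 \<Longrightarrow> \<bar>x s j - y s j\<bar> \<le> K * exp (2 * L * s)" for x y i t K
  proof -
    note ei = exp_int[OF t, of "L * K"]
    have "\<bar>integral {0..t} (\<lambda>s. F (x s) i) - integral {0..t} (\<lambda>s. F (y s) i)\<bar>
       = norm (integral {0..t} (\<lambda>s. F (x s) i - F (y s) i))"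
      by (simp add: integral_diff int x y)
    also have "\<dots> \<le> integral {0..t} (\<lambda>s. L * K * exp (2 * L * s))"
    proof (rule integral_norm_bound_integral)
      show "(\<lambda>s. F (x s) i - F (y s) i) integrable_on {0..t}"
        by (intro integrable_diff int x y)
      show "(\<lambda>s. L * K * exp (2 * L * s)) integrable_on {0..t}"
        using ei by blast
      fix s assume "s \<in> {0..t}"
      then show "norm (F (x s) i - F (y s) i) \<le> L * K * exp (2 * L * s)"
        using Lip[of "x s" "y s" "K * exp (2 * L * s)" i] d by (simp add: mult.assoc)
    qed
    also have "\<dots> = L * K * (exp (2 * L * t) - 1) / (2 * L)"
      by (rule integral_unique[OF ei])
    also have "\<dots> \<le> K / 2 * exp (2 * L * t)"
      using K L by (simp add: field_simps)
    finally show ?thesis .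
  qed
  \<comment> \<open>The first step is at most \<open>\<bar>M\<bar> * t\<close>, and \<open>2 * L * t \<le> exp (2 * L * t)\<close>.\<close>
  define C where "C = \<bar>M\<bar> / (2 * L)"
  have C: "C \<ge> 0" using L by (simp add: C_def)
  have diff: "\<bar>X (Suc n) t i - X n t i\<bar> \<le> C / 2 ^ n * exp (2 * L * t)" if "0 \<le> t" for n t i
    using that
  proof (induction n arbitrary: t i)
    case 0
    have "\<bar>X (Suc 0) t i - X 0 t i\<bar> = t * \<bar>F \<phi> i\<bar>"
      using 0 by (simp add: XS X0 abs_mult)
    also have "\<dots> \<le> t * \<bar>M\<bar>" using bdd[of i] 0 by (intro mult_left_mono) auto
    also have "\<dots> = C * (2 * L * t)" using L by (simp add: C_def)
    also have "\<dots> \<le> C * exp (2 * L * t)"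
      using C exp_ge_add_one_self[of "2 * L * t"] by (intro mult_left_mono) linarith+
    finally show ?case by simp
  next
    case (Suc n)
    have "\<bar>X (Suc (Suc n)) t i - X (Suc n) t i\<bar>
      = \<bar>integral {0..t} (\<lambda>s. F (X (Suc n) s) i) - integral {0..t} (\<lambda>s. F (X n s) i)\<bar>"
      by (simp only: XS add_diff_cancel_left)
    also have "\<dots> \<le> C / 2 ^ n / 2 * exp (2 * L * t)"
      by (rule step[OF Suc.prems Xc Xc _ Suc.IH]) (use C in auto)
    finally show ?case by (simp add: mult.commute)
  qed
  define x where "x t i = lim (\<lambda>n. X n t i)" for t i
  have tail: "\<bar>X (n + m) t i - X n t i\<bar> \<le> 2 * C / 2 ^ n * exp (2 * L * t)" if t: "0 \<le> t" for n m t i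
  proof -
    have "\<bar>X (n + m) t i - X n t i\<bar> \<le> (2 * C / 2 ^ n - 2 * C / 2 ^ (n + m)) * exp (2 * L * t)"
    proof (induction m)
      case (Suc m)
      have "\<bar>X (n + Suc m) t i - X n t i\<bar> \<le> (2 * C / 2 ^ n - 2 * C / 2 ^ (n + m)) * exp (2 * L * t)
         + C / 2 ^ (n + m) * exp (2 * L * t)"
        using Suc diff[OF t, of "n + m" i] by simp
      also have "\<dots> = (2 * C / 2 ^ n - 2 * C / 2 ^ (n + Suc m)) * exp (2 * L * t)"
        by (simp add: field_simps)
      finally show ?case .
    qed simp
    also have "\<dots> \<le> 2 * C / 2 ^ n * exp (2 * L * t)"
      using C by (intro mult_right_mono) auto
    finally show ?thesis .
  qed
  have null: "(\<lambda>n. K / 2 ^ n * E) \<longlonglongrightarrow> 0" for K E :: real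
  proof -
    have "(\<lambda>n. K * E * (1 / 2) ^ n) \<longlonglongrightarrow> K * E * 0"
      by (intro tendsto_intros LIMSEQ_power_zero) simp
    then show ?thesis by (simp add: power_divide mult.commute)
  qed
  have conv: "(\<lambda>n. X n t i) \<longlonglongrightarrow> x t i" if t: "0 \<le> t" for t i
  proof -
    have "Cauchy (\<lambda>n. X n t i)"
    proof (rule CauchyI)
      fix e :: real assume "0 < e"
      then obtain N where N: "2 * C / 2 ^ N * exp (2 * L * t) < e / 2"
        using order_tendstoD(2)[OF null[of "2 * C" "exp (2 * L * t)"], of "e / 2"]
        by (auto simp: eventually_sequentially)
      have "norm (X m t i - X n t i) < e" if "m \<ge> N" "n \<ge> N" for m n
        using tail[OF t, of N "m - N" i] tail[OF t, of N "n - N" i] that N by simp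
      then show "\<exists>N. \<forall>m\<ge>N. \<forall>n\<ge>N. norm (X m t i - X n t i) < e" by blast
    qed
    then show ?thesis
      unfolding x_def by (simp add: Cauchy_convergent_iff convergent_LIMSEQ_iff)
  qed
  have close: "\<bar>x t i - X n t i\<bar> \<le> 2 * C / 2 ^ n * exp (2 * L * t)" if t: "0 \<le> t" for n t i
  proof (rule tendsto_upperbound)
    show "(\<lambda>m. \<bar>X (m + n) t i - X n t i\<bar>) \<longlonglongrightarrow> \<bar>x t i - X n t i\<bar>"
      by (intro tendsto_intros LIMSEQ_ignore_initial_segment conv t)
    show "\<forall>\<^sub>F m in sequentially. \<bar>X (m + n) t i - X n t i\<bar> \<le> 2 * C / 2 ^ n * exp (2 * L * t)"
      using tail[OF t, of n] by (simp add: add.commute)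
  qed simp
  have xc: "continuous_on {0..} (\<lambda>s. x s i)" for i
    unfolding continuous_on_def
  proof
    fix t :: real assume t: "t \<in> {0..}"
    have "uniform_limit {0..t + 1} (\<lambda>n s. X n s i) (\<lambda>s. x s i) sequentially"
    proof (rule uniform_limitI)
      fix e :: real assume "0 < e"
      then have "\<forall>\<^sub>F n in sequentially. 2 * C / 2 ^ n * exp (2 * L * (t + 1)) < e"
        by (rule order_tendstoD(2)[OF null])
      then show "\<forall>\<^sub>F n in sequentially. \<forall>s\<in>{0..t + 1}. dist (X n s i) (x s i) < e"
      proof (rule eventually_mono, intro ballI)
        fix n s assume n: "2 * C / 2 ^ n * exp (2 * L * (t + 1)) < e" and s: "s \<in> {0..t + 1}"
        have "dist (X n s i) (x s i) \<le> 2 * C / 2 ^ n * exp (2 * L * s)"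
          using close[of s i n] s by (simp add: dist_real_def abs_minus_commute)
        also have "\<dots> \<le> 2 * C / 2 ^ n * exp (2 * L * (t + 1))"
          using s L C by (intro mult_left_mono) auto
        finally show "dist (X n s i) (x s i) < e" using n by simp
      qed
    qed
    then have "continuous_on {0..t + 1} (\<lambda>s. x s i)"
      by (rule uniform_limit_theorem[rotated])
        (auto intro!: always_eventually continuous_on_subset[OF Xc])
    then have "((\<lambda>s. x s i) \<longlongrightarrow> x t i) (at t within {0..t + 1})"
      using t by (auto simp: continuous_on_def)
    moreover have "at t within {0..t + 1} = at t within {0..}"
      by (rule at_within_nhd[of _ "{..<t + 1}"]) (use t in auto)
    ultimately show "((\<lambda>s. x s i) \<longlongrightarrow> x t i) (at t within {0..})" by simp
  qed
  have eq: "x t i = \<phi> i + integral {0..t} (\<lambda>s. F (x s) i)" if t: "0 \<le> t" for t i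
  proof -
    have "(\<lambda>n. \<phi> i + integral {0..t} (\<lambda>s. F (X n s) i)) \<longlonglongrightarrow> \<phi> i + integral {0..t} (\<lambda>s. F (x s) i)"
    proof (intro tendsto_intros)
      show "(\<lambda>n. integral {0..t} (\<lambda>s. F (X n s) i)) \<longlonglongrightarrow> integral {0..t} (\<lambda>s. F (x s) i)"
      proof (rule LIM_zero_cancel, rule Lim_null_comparison[OF always_eventually null[of C "exp (2 * L * t)"]], rule)
        show "norm (integral {0..t} (\<lambda>s. F (X n s) i) - integral {0..t} (\<lambda>s. F (x s) i))
          \<le> C / 2 ^ n * exp (2 * L * t)" for n
          using step[OF t, of "X n" x "2 * C / 2 ^ n" i] close Xc xc C
          by (simp add: abs_minus_commute)
      qed
    qed
    moreover have "(\<lambda>n. X (Suc n) t i) \<longlonglongrightarrow> x t i"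
      by (rule LIMSEQ_Suc[OF conv[OF t]])
    ultimately show ?thesis
      unfolding XS by (rule LIMSEQ_unique[rotated])
  qed
  show thesis
  proof (rule that)
    show "x 0 i = \<phi> i" for i using eq[of 0] by simp
    fix t :: real and i assume t: "t \<ge> 0"
    have "((\<lambda>t. \<phi> i + integral {0..t} (\<lambda>s. F (x s) i)) has_real_derivative F (x t) i) (at t within {0..})"
      using has_real_derivative_integral_0[OF cont[of x i] t] xc
      by (auto intro!: derivative_eq_intros)
    then show "((\<lambda>s. x s i) has_real_derivative F (x t) i) (at t within {0..})"
      by (rule has_field_derivative_transform_within[of _ _ _ _ 1]) (use eq t in auto)
  qed
qed

lemma abs_diff_le_of_derivative_bound:
  fixes f f' :: "real \<Rightarrow> real"
  assumes "\<And>s. 0 \<le> s \<Longrightarrow> (f has_real_derivative f' s) (at s within {0..})"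
    and "0 \<le> a" "a \<le> b" and "\<And>s. \<lbrakk>a \<le> s; s \<le> b\<rbrakk> \<Longrightarrow> \<bar>f' s\<bar> \<le> B"
  shows "\<bar>f b - f a\<bar> \<le> B * (b - a)"
proof -
  have "norm (f b - f a) \<le> B * norm (b - a)"
  proof (rule field_differentiable_bound[of "{a..b}"])
    show "(f has_real_derivative f' s) (at s within {a..b})" if "s \<in> {a..b}" for s
      using assms(1)[of s] assms(2) that by (auto elim!: DERIV_subset)
  qed (use assms in auto)
  then show ?thesis using assms(3) by simp
qed

lemma nonincreasing_of_nonpos_derivative:
  fixes f f' :: "real \<Rightarrow> real"
  assumes d: "\<And>s. 0 \<le> s \<Longrightarrow> (f has_real_derivative f' s) (at s within {0..})"
    and "0 \<le> T" and le: "\<And>s. \<lbrakk>0 \<le> s; s \<le> T\<rbrakk> \<Longrightarrow> f' s \<le> 0"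
  shows "f T \<le> f 0"
proof (cases "T = 0")
  case False
  show ?thesis
  proof (rule DERIV_nonpos_imp_decreasing_open[OF \<open>0 \<le> T\<close>])
    show "continuous_on {0..T} f"
    proof (rule continuous_on_subset)
      show "continuous_on {0..} f" using d by (intro DERIV_continuous_on) auto
    qed auto
    show "\<exists>y. (f has_real_derivative y) (at x) \<and> y \<le> 0" if "0 < x" "x < T" for x
    proof -
      have "at x within {0..} = at x" using that by (intro at_within_interior) auto
      then show ?thesis using d[of x] le[of x] that by auto
    qed
  qed
qed simp

text \<open>
  Barbalat's lemma: each time \<open>t\<close> with \<open>g t \<ge> e\<close> is followed by an interval of fixed length on
  which \<open>g \<ge> e / 2\<close>, which adds a fixed amount to the integral.
\<close>

lemma tendsto_0_of_bounded_integral: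
  fixes g :: "real \<Rightarrow> real"
  assumes nonneg: "\<And>t. 0 \<le> t \<Longrightarrow> 0 \<le> g t"
    and lip: "\<And>s t. \<lbrakk>0 \<le> s; s \<le> t\<rbrakk> \<Longrightarrow> \<bar>g t - g s\<bar> \<le> K * (t - s)" and K: "K > 0"
    and cont: "continuous_on {0..} g"
    and bound: "\<And>T. 0 \<le> T \<Longrightarrow> integral {0..T} g \<le> M"
  shows "(g \<longlongrightarrow> 0) at_top"
proof -
  define P where "P t = integral {0..t} g" for t
  have int: "g integrable_on {a..b}" if "0 \<le> a" for a b
    by (rule integrable_continuous_real, rule continuous_on_subset[OF cont]) (use that in auto)
  have split: "P (t + h) = P t + integral {t..t + h} g" if "0 \<le> t" "0 \<le> h" for t h
    unfolding P_def using that by (intro Henstock_Kurzweil_Integration.integral_combine[symmetric] int) auto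
  have mono: "P s \<le> P t" if "0 \<le> s" "s \<le> t" for s t
  proof -
    have "0 \<le> integral {s..t} g" using that by (intro integral_nonneg int nonneg) auto
    then show ?thesis using split[of s "t - s"] that by simp
  qed
  define L where "L = (SUP t\<in>{0..}. P t)"
  have bdd: "bdd_above (P ` {0..})" using bound by (auto simp: P_def intro!: bdd_aboveI2)
  show ?thesis
  proof (rule tendstoI)
    fix e :: real assume e: "0 < e"
    \<comment> \<open>In a time \<open>h\<close> the function \<open>g\<close> changes by at most \<open>e / 2\<close>.\<close>
    define h where "h = e / (2 * K)"
    have h: "0 < h" using e K by (simp add: h_def)
    have "L - e * h / 2 < L" using e h by simp
    then obtain t0 where t0: "0 \<le> t0" "L - e * h / 2 < P t0"
      unfolding L_def by (subst (asm) less_cSUP_iff) (use bdd in auto)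
    show "\<forall>\<^sub>F t in at_top. dist (g t) 0 < e"
      using eventually_ge_at_top[of t0]
    proof (rule eventually_mono)
      fix t assume t: "t0 \<le> t"
      show "dist (g t) 0 < e"
      proof (rule ccontr)
        assume "\<not> dist (g t) 0 < e"
        then have ge: "e \<le> g t" using nonneg[of t] t t0 by (simp add: dist_real_def)
        have "e / 2 \<le> g s" if "s \<in> {t..t + h}" for s
        proof -
          have "\<bar>g s - g t\<bar> \<le> K * (s - t)" using that t t0 by (intro lip) auto
          also have "\<dots> \<le> K * h" using that K by (intro mult_left_mono) auto
          also have "\<dots> = e / 2" using K by (simp add: h_def)
          finally show ?thesis using ge by linarith
        qed
        then have "integral {t..t + h} (\<lambda>_. e / 2) \<le> integral {t..t + h} g"
          using t t0 by (intro integral_le int) auto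
        then have "e * h / 2 \<le> integral {t..t + h} g" using h by (simp add: mult.commute)
        moreover have "P (t + h) \<le> L" unfolding L_def by (rule cSUP_upper[OF _ bdd]) (use t t0 h in auto)
        ultimately show False using split[of t h] mono[of t0 t] t t0 h by simp
      qed
    qed
  qed
qed

section \<open>The localised energy\<close>

definition lattice_box :: "nat \<Rightarrow> vertex set" where
  "lattice_box R = {- int R..int R} \<times> {- int R..int R}"

definition cutoff :: "nat \<Rightarrow> vertex \<Rightarrow> real" where
  "cutoff R i = max 0 (1 - max \<bar>real_of_int (fst i)\<bar> \<bar>real_of_int (snd i)\<bar> / real R)"

lemma finite_lattice_box [simp]: "finite (lattice_box R)"
  by (simp add: lattice_box_def)

lemma card_lattice_box: "card (lattice_box R) = (2 * R + 1)\<^sup>2"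
proof -
  have "card {- int R..int R} = 2 * R + 1" by simp
  then show ?thesis by (simp only: lattice_box_def card_cartesian_product power2_eq_square)
qed

lemma cutoff_bounds: "0 \<le> cutoff R i" "cutoff R i \<le> 1"
  by (simp_all add: cutoff_def)

lemma cutoff_outside_lattice_box:
  assumes "R > 0" "i \<notin> lattice_box R"
  shows "cutoff R i = 0"
proof -
  have "int R < max \<bar>fst i\<bar> \<bar>snd i\<bar>" using assms by (cases i) (auto simp: lattice_box_def)
  then have "real R < max \<bar>real_of_int (fst i)\<bar> \<bar>real_of_int (snd i)\<bar>"
    by (metis of_int_abs of_int_less_iff of_int_max of_int_of_nat_eq)
  then show ?thesis using assms by (simp add: cutoff_def field_simps)
qed

lemma cutoff_neighbours:
  assumes "R > 0" "\<bar>fst i - fst j\<bar> \<le> 1" "\<bar>snd i - snd j\<bar> \<le> 1"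
  shows "\<bar>cutoff R i - cutoff R j\<bar> \<le> 1 / real R"
proof -
  define a b where "a = max \<bar>real_of_int (fst i)\<bar> \<bar>real_of_int (snd i)\<bar>"
    and "b = max \<bar>real_of_int (fst j)\<bar> \<bar>real_of_int (snd j)\<bar>"
  have "\<bar>real_of_int (fst i) - real_of_int (fst j)\<bar> \<le> 1" "\<bar>real_of_int (snd i) - real_of_int (snd j)\<bar> \<le> 1"
    using assms(2,3) by linarith+
  then have "\<bar>a - b\<bar> \<le> 1" unfolding a_def b_def by linarith
  then have "\<bar>a / real R - b / real R\<bar> \<le> 1 / real R"
    using assms(1) by (simp add: divide_right_mono flip: diff_divide_distrib)
  then show ?thesis unfolding cutoff_def a_def[symmetric] b_def[symmetric] by linarith
qed

lemma cutoff_tendsto_1: "(\<lambda>R. cutoff R i) \<longlonglongrightarrow> 1"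
proof -
  have "(\<lambda>R. max 0 (1 - max \<bar>real_of_int (fst i)\<bar> \<bar>real_of_int (snd i)\<bar> / real R)) \<longlonglongrightarrow> max 0 (1 - 0)"
    by (intro tendsto_intros lim_const_over_n)
  then show ?thesis by (simp add: cutoff_def)
qed

lemma finite_subset_lattice_box_eventually:
  assumes "finite A"
  shows "\<forall>\<^sub>F R in sequentially. A \<subseteq> lattice_box R"
proof -
  have "\<forall>\<^sub>F R in sequentially. i \<in> lattice_box R" for i
    using eventually_ge_at_top[of "nat (max \<bar>fst i\<bar> \<bar>snd i\<bar>)"]
    by (rule eventually_mono) (cases i, auto simp: lattice_box_def)
  then show ?thesis
    unfolding subset_eq by (intro eventually_ball_finite assms ballI)
qed

context near_regular
begin

text \<open>
  The vertex \<open>i\<close> whose weight multiplies the dissipation may be any vertex of the face; of the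
  spread only the edge \<open>ij\<close> is kept.
\<close>

lemma face_energy:
  assumes "R > 0" and f: "{i, j, k} \<in> F_H"
  shows "(\<Sum>l\<in>{i, j, k}. (cutoff R l)\<^sup>2 * w l * face_excess (trunc \<circ> w) l {i, j, k})
    \<le> - ((cutoff R i)\<^sup>2 * (trunc (w i) - trunc (w j))\<^sup>2 / 20)
      + 44 * (1 / real R)\<^sup>2 * (\<Sum>l\<in>{i, j, k}. (w l)\<^sup>2)"
proof -
  define a b c where "a = trunc (w i)" and "b = trunc (w j)" and "c = trunc (w k)"
  have perms: "{j, k, i} \<in> F_H" "{k, i, j} \<in> F_H" "{j, k, i} = {i, j, k}" "{k, i, j} = {i, j, k}"
    using f by (auto simp: insert_commute)
  have t: "\<bar>(trunc \<circ> w) l\<bar> \<le> \<delta>" for l by (simp add: abs_trunc_le)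
  have fe: "face_excess (trunc \<circ> w) i {i, j, k} = excess a b c"
    "face_excess (trunc \<circ> w) j {i, j, k} = excess b c a"
    "face_excess (trunc \<circ> w) k {i, j, k} = excess c a b"
    using face_excess_eq[of "trunc \<circ> w", OF t f] face_excess_eq[of "trunc \<circ> w", OF t perms(1)]
      face_excess_eq[of "trunc \<circ> w", OF t perms(2)]
    by (simp_all add: a_def b_def c_def perms)
  have near: "\<bar>cutoff R j - cutoff R i\<bar> \<le> 1 / real R" "\<bar>cutoff R k - cutoff R i\<bar> \<le> 1 / real R"
    by (intro cutoff_neighbours face_neighbours[OF f] assms; simp)+
  have "(cutoff R i)\<^sup>2 * (a - b)\<^sup>2 \<le> (cutoff R i)\<^sup>2 * spread a b c"
    by (intro mult_left_mono) (simp_all add: spread_def)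
  then show ?thesis
    using weighted_energy_dissipation[OF a_def b_def c_def cutoff_bounds(1) cutoff_bounds(1) cutoff_bounds(1) near]
    unfolding sum_face[OF f] fe by (simp add: a_def[symmetric] b_def[symmetric] algebra_simps)
qed

text \<open>
  Summation by parts: exchanging the sums over vertices and faces turns the weighted energy rate
  into a sum of the per-face quantities bounded in \<open>face_energy\<close>. The dissipation is kept for
  one face only. Each vertex lies in six faces, and \<open>264 = 6 * 44\<close>.
\<close>

lemma cutoff_energy_rate:
  assumes R: "R > 0" and f0: "{i, j, k} \<in> F_H" and i: "i \<in> lattice_box R"
  shows "- (\<Sum>l\<in>lattice_box R. (cutoff R l)\<^sup>2 * w l * curvature (trunc \<circ> w) l)
    \<le> - ((cutoff R i)\<^sup>2 * (trunc (w i) - trunc (w j))\<^sup>2 / 20)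
      + 264 / (real R)\<^sup>2 * (\<Sum>l\<in>lattice_box (R + 1). (w l)\<^sup>2)"
proof -
  define \<F> where "\<F> = (\<Union>l\<in>lattice_box R. faces_at l)"
  \<comment> \<open>The dissipation of the distinguished face, written as a function of the face.\<close>
  define h where "h \<Delta> = (if \<Delta> = {i, j, k} then (cutoff R i)\<^sup>2 * (trunc (w i) - trunc (w j))\<^sup>2 / 20 else 0)" for \<Delta>
  define X where "X l \<Delta> = (cutoff R l)\<^sup>2 * w l * face_excess (trunc \<circ> w) l \<Delta>" for l \<Delta>
  have fin: "finite \<F>" by (simp add: \<F>_def)
  have at: "{\<Delta> \<in> \<F>. l \<in> \<Delta>} = faces_at l" if "l \<in> lattice_box R" for l
    using that by (auto simp: \<F>_def)
  have finD: "finite \<Delta>" if "\<Delta> \<in> F_H" for \<Delta> using that by (auto simp: in_F_H_iff up_face_def down_face_def)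
  have overlap: "(\<Sum>\<Delta>\<in>\<F>. \<Sum>l\<in>\<Delta>. (w l)\<^sup>2) \<le> 6 * (\<Sum>l\<in>lattice_box (R + 1). (w l)\<^sup>2)"
  proof -
    have "(\<Sum>\<Delta>\<in>\<F>. \<Sum>l\<in>\<Delta>. (w l)\<^sup>2) = (\<Sum>\<Delta>\<in>\<F>. \<Sum>l | l \<in> lattice_box (R + 1) \<and> l \<in> \<Delta>. (w l)\<^sup>2)"
    proof (intro sum.cong refl)
      fix \<Delta> assume "\<Delta> \<in> \<F>"
      then obtain a where a: "a \<in> lattice_box R" "\<Delta> \<in> F_H" "a \<in> \<Delta>" by (auto simp: \<F>_def)
      have "l \<in> lattice_box (R + 1)" if "l \<in> \<Delta>" for l
        using face_neighbours[OF a(2,3) that] a(1) by (cases a; cases l) (auto simp: lattice_box_def)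
      then show "\<Delta> = {l. l \<in> lattice_box (R + 1) \<and> l \<in> \<Delta>}" by auto
    qed
    also have "\<dots> = (\<Sum>l\<in>lattice_box (R + 1). \<Sum>\<Delta> | \<Delta> \<in> \<F> \<and> l \<in> \<Delta>. (w l)\<^sup>2)"
      by (rule sum.swap_restrict[symmetric]) (simp_all add: fin)
    also have "\<dots> \<le> (\<Sum>l\<in>lattice_box (R + 1). 6 * (w l)\<^sup>2)"
    proof (rule sum_mono)
      fix l
      have "card {\<Delta>. \<Delta> \<in> \<F> \<and> l \<in> \<Delta>} \<le> 6"
        unfolding card_faces_at[of l, symmetric] by (intro card_mono) (auto simp: \<F>_def)
      then show "(\<Sum>\<Delta> | \<Delta> \<in> \<F> \<and> l \<in> \<Delta>. (w l)\<^sup>2) \<le> 6 * (w l)\<^sup>2"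
        by (simp add: mult_right_mono)
    qed
    finally show ?thesis by (simp only: sum_distrib_left)
  qed
  have "- (\<Sum>l\<in>lattice_box R. (cutoff R l)\<^sup>2 * w l * curvature (trunc \<circ> w) l)
      = (\<Sum>l\<in>lattice_box R. (cutoff R l)\<^sup>2 * w l * (- curvature (trunc \<circ> w) l))"
    by (simp add: sum_negf)
  also have "\<dots> = (\<Sum>l\<in>lattice_box R. \<Sum>\<Delta>\<in>{\<Delta> \<in> \<F>. l \<in> \<Delta>}. X l \<Delta>)"
    unfolding curvature_eq by (intro sum.cong refl) (simp add: at X_def sum_distrib_left)
  also have "\<dots> = (\<Sum>\<Delta>\<in>\<F>. \<Sum>l | l \<in> lattice_box R \<and> l \<in> \<Delta>. X l \<Delta>)"
    by (rule sum.swap_restrict) (simp_all add: fin)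
  also have "\<dots> = (\<Sum>\<Delta>\<in>\<F>. \<Sum>l\<in>\<Delta>. X l \<Delta>)"
  proof (rule sum.cong[OF refl], rule sum.mono_neutral_left)
    fix \<Delta> assume "\<Delta> \<in> \<F>"
    then show "finite \<Delta>" using finD by (auto simp: \<F>_def)
    show "\<forall>l\<in>\<Delta> - {l. l \<in> lattice_box R \<and> l \<in> \<Delta>}. X l \<Delta> = 0"
      using cutoff_outside_lattice_box[OF R] by (auto simp: X_def)
  qed auto
  also have "\<dots> \<le> (\<Sum>\<Delta>\<in>\<F>. - h \<Delta> + 44 * (1 / real R)\<^sup>2 * (\<Sum>l\<in>\<Delta>. (w l)\<^sup>2))"
  proof (rule sum_mono)
    fix \<Delta> assume "\<Delta> \<in> \<F>"
    then obtain a where a: "\<Delta> \<in> F_H" "a \<in> \<Delta>" by (auto simp: \<F>_def)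
    show "(\<Sum>l\<in>\<Delta>. X l \<Delta>) \<le> - h \<Delta> + 44 * (1 / real R)\<^sup>2 * (\<Sum>l\<in>\<Delta>. (w l)\<^sup>2)"
    proof (cases "\<Delta> = {i, j, k}")
      case True
      then show ?thesis using face_energy[OF R f0, of w] by (simp only: X_def h_def refl if_True)
    next
      case False
      obtain b c where abc: "\<Delta> = {a, b, c}" using face_cases[OF a] .
      have "{a, b, c} \<in> F_H" using a abc by simp
      from face_energy[OF R this, of w] False
      have "(\<Sum>l\<in>\<Delta>. X l \<Delta>) \<le> - ((cutoff R a)\<^sup>2 * (trunc (w a) - trunc (w b))\<^sup>2 / 20)
          + 44 * (1 / real R)\<^sup>2 * (\<Sum>l\<in>\<Delta>. (w l)\<^sup>2)"
        unfolding X_def abc by simp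
      moreover have "0 \<le> (cutoff R a)\<^sup>2 * (trunc (w a) - trunc (w b))\<^sup>2 / 20" by simp
      moreover have "h \<Delta> = 0" using False by (simp add: h_def)
      ultimately show ?thesis by linarith
    qed
  qed
  also have "\<dots> = - (\<Sum>\<Delta>\<in>\<F>. h \<Delta>) + 44 * (1 / real R)\<^sup>2 * (\<Sum>\<Delta>\<in>\<F>. \<Sum>l\<in>\<Delta>. (w l)\<^sup>2)"
    by (simp only: sum.distrib sum_negf sum_distrib_left)
  also have "(\<Sum>\<Delta>\<in>\<F>. h \<Delta>) = (cutoff R i)\<^sup>2 * (trunc (w i) - trunc (w j))\<^sup>2 / 20"
    unfolding h_def using f0 i by (subst sum.delta[OF fin]) (auto simp: \<F>_def)
  also have "44 * (1 / real R)\<^sup>2 * (\<Sum>\<Delta>\<in>\<F>. \<Sum>l\<in>\<Delta>. (w l)\<^sup>2)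
      \<le> 44 * (1 / real R)\<^sup>2 * (6 * (\<Sum>l\<in>lattice_box (R + 1). (w l)\<^sup>2))"
    by (rule mult_left_mono[OF overlap]) simp
  also have "\<dots> = 264 / (real R)\<^sup>2 * (\<Sum>l\<in>lattice_box (R + 1). (w l)\<^sup>2)"
    by (simp add: power_divide)
  finally show ?thesis by (simp only: add_left_mono)
qed

end

section \<open>The truncated flow: energy and convergence\<close>

text \<open>
  The initial energy is bounded through its finite partial sums, the form in which the energy at
  later times will be obtained, so that no summability has to be carried along.
\<close>

locale truncated_flow = near_regular +
  fixes \<phi> :: "vertex \<Rightarrow> real" and u :: "real \<Rightarrow> vertex \<Rightarrow> real" and M :: real
  assumes flow: "0 \<le> t \<Longrightarrow>
      ((\<lambda>s. u s i) has_real_derivative - curvature (trunc \<circ> u t) i) (at t within {0..})"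
    and initial: "u 0 i = \<phi> i"
    and initial_energy: "finite A \<Longrightarrow> (\<Sum>i\<in>A. (\<phi> i)\<^sup>2) \<le> M"
begin

lemma curvature_trunc_bound: "\<bar>curvature (trunc \<circ> w) i\<bar> \<le> 4 * pi"
  by (intro abs_curvature_le PL_metric_near_regular) (simp add: abs_trunc_le)

lemma u_lipschitz:
  assumes "0 \<le> s" "s \<le> t"
  shows "\<bar>u t i - u s i\<bar> \<le> 4 * pi * (t - s)"
  by (rule abs_diff_le_of_derivative_bound[OF flow assms]) (simp_all add: curvature_trunc_bound)

lemma continuous_on_u: "continuous_on {0..} (\<lambda>t. u t i)"
  by (rule DERIV_continuous_on[OF flow]) simp

lemma u_growth:
  assumes "0 \<le> t"
  shows "\<bar>u t i\<bar> \<le> sqrt M + 4 * pi * t"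
proof -
  have "\<bar>\<phi> i\<bar> \<le> sqrt M" using initial_energy[of "{i}"] by (simp add: real_le_rsqrt)
  then show ?thesis using u_lipschitz[of 0 t i] assms by (simp add: initial)
qed

definition dissipated :: "vertex \<Rightarrow> vertex \<Rightarrow> real \<Rightarrow> real" where
  "dissipated i j T = integral {0..T} (\<lambda>t. (trunc (u t i) - trunc (u t j))\<^sup>2)"

lemma continuous_on_trunc_diff: "continuous_on {0..} (\<lambda>t. (trunc (u t i) - trunc (u t j))\<^sup>2)"
  unfolding trunc_def by (intro continuous_intros continuous_on_u)

lemma cutoff_energy_inequality:
  assumes R: "R > 0" and f: "{i, j, k} \<in> F_H" and i: "i \<in> lattice_box R" and T: "0 \<le> T"
    and Z: "\<And>t. \<lbrakk>0 \<le> t; t \<le> T\<rbrakk> \<Longrightarrow> (\<Sum>l\<in>lattice_box (R + 1). (u t l)\<^sup>2) \<le> Z"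
  shows "(\<Sum>l\<in>lattice_box R. (cutoff R l)\<^sup>2 * (u T l)\<^sup>2) + (cutoff R i)\<^sup>2 * dissipated i j T / 10
    \<le> M + 528 / (real R)\<^sup>2 * Z * T"
proof -
  define E where "E t = (\<Sum>l\<in>lattice_box R. (cutoff R l)\<^sup>2 * (u t l)\<^sup>2) + (cutoff R i)\<^sup>2 * dissipated i j t / 10
    - 528 / (real R)\<^sup>2 * Z * t" for t
  define E' where "E' t = (\<Sum>l\<in>lattice_box R. 2 * ((cutoff R l)\<^sup>2 * u t l * (- curvature (trunc \<circ> u t) l)))
    + (cutoff R i)\<^sup>2 * (trunc (u t i) - trunc (u t j))\<^sup>2 / 10 - 528 / (real R)\<^sup>2 * Z" for t
  have "E T \<le> E 0"
  proof (rule nonincreasing_of_nonpos_derivative[OF _ T])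
    fix t :: real assume t: "0 \<le> t"
    have D: "((\<lambda>t. dissipated i j t) has_real_derivative (trunc (u t i) - trunc (u t j))\<^sup>2) (at t within {0..})"
      unfolding dissipated_def by (rule has_real_derivative_integral_0[OF continuous_on_trunc_diff t])
    have U: "((\<lambda>t. (cutoff R l)\<^sup>2 * (u t l)\<^sup>2) has_real_derivative
        2 * ((cutoff R l)\<^sup>2 * u t l * (- curvature (trunc \<circ> u t) l))) (at t within {0..})" for l
      using DERIV_cmult[OF DERIV_power[OF flow[OF t, of l], of 2], of "(cutoff R l)\<^sup>2"]
      by (simp add: algebra_simps)
    have W: "((\<lambda>t. 528 / (real R)\<^sup>2 * Z * t) has_real_derivative 528 / (real R)\<^sup>2 * Z) (at t within {0..})"
      using DERIV_cmult[OF DERIV_ident, of "528 / (real R)\<^sup>2 * Z"] by (simp only: mult_1_right)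
    show "(E has_real_derivative E' t) (at t within {0..})"
      unfolding E_def E'_def
      by (intro DERIV_diff DERIV_add DERIV_sum U DERIV_cdivide DERIV_cmult D W)
    assume "t \<le> T"
    then have "264 / (real R)\<^sup>2 * (\<Sum>l\<in>lattice_box (R + 1). (u t l)\<^sup>2) \<le> 264 / (real R)\<^sup>2 * Z"
      using Z t by (intro mult_left_mono) auto
    moreover have "E' t = 2 * (- (\<Sum>l\<in>lattice_box R. (cutoff R l)\<^sup>2 * u t l * curvature (trunc \<circ> u t) l))
       + (cutoff R i)\<^sup>2 * (trunc (u t i) - trunc (u t j))\<^sup>2 / 10 - 2 * (264 / (real R)\<^sup>2 * Z)"
      by (simp add: E'_def sum_negf flip: sum_distrib_left)
    ultimately show "E' t \<le> 0"
      using cutoff_energy_rate[OF R f i, of "u t"] by linarith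
  qed
  moreover have "E 0 \<le> M"
  proof -
    have "E 0 = (\<Sum>l\<in>lattice_box R. (cutoff R l)\<^sup>2 * (\<phi> l)\<^sup>2)" by (simp add: E_def dissipated_def initial)
    also have "\<dots> \<le> (\<Sum>l\<in>lattice_box R. (\<phi> l)\<^sup>2)"
      using cutoff_bounds[of R] by (intro sum_mono mult_left_le_one_le) (simp_all add: power_le_one)
    also have "\<dots> \<le> M" by (simp add: initial_energy)
    finally show ?thesis .
  qed
  ultimately show ?thesis by (simp add: E_def)
qed

text \<open>
  The cutoffs increase to \<open>1\<close> and a finite set is eventually inside the box.
\<close>

lemma remove_cutoff:
  assumes c: "c \<longlonglongrightarrow> c0" and A: "finite A"
    and ev: "\<forall>\<^sub>F R in sequentially.
      (\<Sum>l\<in>lattice_box R. (cutoff R l)\<^sup>2 * (u T l)\<^sup>2) + (cutoff R i)\<^sup>2 * D / 10 \<le> M + c R"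
  shows "(\<Sum>l\<in>A. (u T l)\<^sup>2) + D / 10 \<le> M + c0"
proof (rule tendsto_le[OF sequentially_bot])
  show "(\<lambda>R. M + c R) \<longlonglongrightarrow> M + c0" by (intro tendsto_intros c)
  have "(\<lambda>R. (\<Sum>l\<in>A. (cutoff R l)\<^sup>2 * (u T l)\<^sup>2) + (cutoff R i)\<^sup>2 * D / 10)
      \<longlonglongrightarrow> (\<Sum>l\<in>A. 1\<^sup>2 * (u T l)\<^sup>2) + 1\<^sup>2 * D / 10"
    by (intro tendsto_intros cutoff_tendsto_1) simp_all
  then show "(\<lambda>R. (\<Sum>l\<in>A. (cutoff R l)\<^sup>2 * (u T l)\<^sup>2) + (cutoff R i)\<^sup>2 * D / 10)
      \<longlonglongrightarrow> (\<Sum>l\<in>A. (u T l)\<^sup>2) + D / 10" by simp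
  show "\<forall>\<^sub>F R in sequentially. (\<Sum>l\<in>A. (cutoff R l)\<^sup>2 * (u T l)\<^sup>2) + (cutoff R i)\<^sup>2 * D / 10 \<le> M + c R"
    using ev finite_subset_lattice_box_eventually[OF A]
  proof eventually_elim
    case (elim R)
    have "(\<Sum>l\<in>A. (cutoff R l)\<^sup>2 * (u T l)\<^sup>2) \<le> (\<Sum>l\<in>lattice_box R. (cutoff R l)\<^sup>2 * (u T l)\<^sup>2)"
      by (rule sum_mono2) (use elim in auto)
    then show ?case using elim by linarith
  qed
qed

lemma dissipated_nonneg: "0 \<le> dissipated i j T"
  unfolding dissipated_def
  by (intro integral_nonneg integrable_continuous_real continuous_on_subset[OF continuous_on_trunc_diff]) auto

text \<open>
  A first, crude use of the energy inequality: on \<open>[0, T]\<close> the solution is bounded by some \<open>B\<close>, so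
  the energy in the box of radius \<open>R + 1\<close> is of order \<open>R\<^sup>2 * B\<^sup>2\<close>. This is just compensated by the
  factor \<open>1 / R\<^sup>2\<close>, and the resulting bound is independent of \<open>R\<close>.
\<close>

lemma energy_locally_bounded:
  assumes T: "0 \<le> T"
  obtains Z where "\<And>t A. \<lbrakk>0 \<le> t; t \<le> T; finite A\<rbrakk> \<Longrightarrow> (\<Sum>l\<in>A. (u t l)\<^sup>2) \<le> Z"
proof
  fix t and A :: "vertex set" assume t: "0 \<le> t" "t \<le> T" and A: "finite A"
  define B where "B = sqrt M + 4 * pi * T"
  define C where "C = 528 * 25 * B\<^sup>2 * T"
  \<comment> \<open>Any face will do, as its dissipation is discarded.\<close>
  define i :: vertex where "i = (0, 0)"
  have f: "{i, (1, 0), (0, 1)} \<in> F_H" 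
    unfolding in_F_H_iff up_face_def i_def by (rule exI[of _ 0], rule exI[of _ 0]) simp
  have "(\<Sum>l\<in>A. (u t l)\<^sup>2) + dissipated i (1, 0) t / 10 \<le> M + C"
  proof (rule remove_cutoff[OF tendsto_const A])
    show "\<forall>\<^sub>F R in sequentially.
      (\<Sum>l\<in>lattice_box R. (cutoff R l)\<^sup>2 * (u t l)\<^sup>2) + (cutoff R i)\<^sup>2 * dissipated i (1, 0) t / 10 \<le> M + C"
      using eventually_gt_at_top[of 0]
    proof eventually_elim
      case (elim R)
      \<comment> \<open>The number of vertices in the box of radius \<open>R + 1\<close> times the bound for one vertex.\<close>
      define Z where "Z = real (2 * (R + 1) + 1)^2 * B\<^sup>2"
      have "(\<Sum>l\<in>lattice_box (R + 1). (u s l)\<^sup>2) \<le> Z" if "0 \<le> s" "s \<le> t" for s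
      proof -
        have "(u s l)\<^sup>2 \<le> B\<^sup>2" for l
        proof -
          have "sqrt M + 4 * pi * s \<le> B" using that t by (simp add: B_def)
          then have "\<bar>u s l\<bar> \<le> B" using u_growth[of s l] that by linarith
          then show ?thesis by (metis abs_ge_zero power2_abs power_mono)
        qed
        then have "(\<Sum>l\<in>lattice_box (R + 1). (u s l)\<^sup>2) \<le> of_nat (card (lattice_box (R + 1))) * B\<^sup>2"
          by (intro sum_bounded_above)
        then show ?thesis by (simp only: card_lattice_box Z_def of_nat_power)
      qed
      then have "(\<Sum>l\<in>lattice_box R. (cutoff R l)\<^sup>2 * (u t l)\<^sup>2) + (cutoff R i)\<^sup>2 * dissipated i (1, 0) t / 10
          \<le> M + 528 / (real R)\<^sup>2 * Z * t"
        using elim t by (intro cutoff_energy_inequality[OF _ f]) (auto simp: i_def lattice_box_def)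
      also have "528 / (real R)\<^sup>2 * Z * t \<le> 528 * 25 * B\<^sup>2 * T"
      proof (rule mult_mono[OF _ t(2)])
        \<comment> \<open>The constant \<open>25\<close>: \<open>2 * R + 3 \<le> 5 * R\<close> for \<open>R \<ge> 1\<close>.\<close>
        have "real (2 * (R + 1) + 1)^2 \<le> (5 * real R)^2"
          using elim by (intro power_mono) auto
        then have "real (2 * (R + 1) + 1)^2 / (real R)\<^sup>2 \<le> 25"
          using elim by (simp add: power_mult_distrib divide_le_eq)
        then have "real (2 * (R + 1) + 1)^2 / (real R)\<^sup>2 * (528 * B\<^sup>2) \<le> 25 * (528 * B\<^sup>2)"
          by (rule mult_right_mono) simp
        then show "528 / (real R)\<^sup>2 * Z \<le> 528 * 25 * B\<^sup>2"
          by (simp add: Z_def mult_ac)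
      qed (use t in auto)
      finally show ?case by (simp add: C_def)
    qed
  qed
  then show "(\<Sum>l\<in>A. (u t l)\<^sup>2) \<le> M + 528 * 25 * (sqrt M + 4 * pi * T)\<^sup>2 * T"
    using dissipated_nonneg[of i "(1, 0)" t] by (simp add: C_def B_def)
qed

text \<open>
  The second use of the energy inequality: with the energy known to be finite, the error
  term is of order \<open>1 / R\<^sup>2\<close> and disappears in the limit.
\<close>

lemma energy_inequality:
  assumes f: "{i, j, k} \<in> F_H" and T: "0 \<le> T" and A: "finite A"
  shows "(\<Sum>l\<in>A. (u T l)\<^sup>2) + dissipated i j T / 10 \<le> M"
proof -
  obtain Z where Z: "\<And>t A. \<lbrakk>0 \<le> t; t \<le> T; finite A\<rbrakk> \<Longrightarrow> (\<Sum>l\<in>A. (u t l)\<^sup>2) \<le> Z"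
    using energy_locally_bounded[OF T] by blast
  have "(\<Sum>l\<in>A. (u T l)\<^sup>2) + dissipated i j T / 10 \<le> M + 0"
  proof (rule remove_cutoff[OF _ A])
    have "(\<lambda>R. 528 * Z * T * (1 / real R)\<^sup>2) \<longlonglongrightarrow> 528 * Z * T * 0\<^sup>2"
      by (intro tendsto_intros lim_const_over_n)
    then show "(\<lambda>R. 528 / (real R)\<^sup>2 * Z * T) \<longlonglongrightarrow> 0" by (simp add: power_divide)
    show "\<forall>\<^sub>F R in sequentially. (\<Sum>l\<in>lattice_box R. (cutoff R l)\<^sup>2 * (u T l)\<^sup>2)
        + (cutoff R i)\<^sup>2 * dissipated i j T / 10 \<le> M + 528 / (real R)\<^sup>2 * Z * T"
      using eventually_gt_at_top[of 0] finite_subset_lattice_box_eventually[of "{i}", OF finite.insertI[OF finite.emptyI]]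
    proof eventually_elim
      case (elim R)
      show ?case
        by (rule cutoff_energy_inequality[OF _ f _ T]) (use elim in \<open>simp_all add: Z\<close>)
    qed
  qed
  then show ?thesis by simp
qed

lemma trunc_diff_tendsto_0:
  assumes f: "{i, j, k} \<in> F_H"
  shows "((\<lambda>t. trunc (u t i) - trunc (u t j)) \<longlongrightarrow> 0) at_top"
proof -
  define d where "d t = trunc (u t i) - trunc (u t j)" for t
  have d_le: "\<bar>d t\<bar> \<le> 2 * \<delta>" for t
    using abs_trunc_le(1)[of "u t i"] abs_trunc_le(1)[of "u t j"] unfolding d_def by linarith
  have "((\<lambda>t. (d t)\<^sup>2) \<longlongrightarrow> 0) at_top"
  proof (rule tendsto_0_of_bounded_integral)
    show "continuous_on {0..} (\<lambda>t. (d t)\<^sup>2)" unfolding d_def by (rule continuous_on_trunc_diff)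
    show "integral {0..T} (\<lambda>t. (d t)\<^sup>2) \<le> 10 * M" if "0 \<le> T" for T
      using energy_inequality[OF f that finite.emptyI] by (simp add: dissipated_def d_def)
    show "0 < 32 * pi * \<delta>" using \<delta>_pos by simp
    show "\<bar>(d t)\<^sup>2 - (d s)\<^sup>2\<bar> \<le> 32 * pi * \<delta> * (t - s)" if "0 \<le> s" "s \<le> t" for s t
    proof -
      have "\<bar>d t - d s\<bar> \<le> \<bar>u t i - u s i\<bar> + \<bar>u t j - u s j\<bar>"
        using abs_trunc_diff_le[of "u t i" "u s i"] abs_trunc_diff_le[of "u t j" "u s j"]
        unfolding d_def by linarith
      also have "\<dots> \<le> 8 * pi * (t - s)"
        using u_lipschitz[OF that, of i] u_lipschitz[OF that, of j] by linarith
      finally have "\<bar>d t - d s\<bar> * \<bar>d t + d s\<bar> \<le> (8 * pi * (t - s)) * (4 * \<delta>)"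
        using d_le[of t] d_le[of s] that by (intro mult_mono) auto
      then show ?thesis
        by (simp add: power2_eq_square algebra_simps flip: abs_mult)
    qed
  qed simp
  then show ?thesis unfolding d_def by simp
qed

text \<open>
  Since differences along edges tend to zero, the value at \<open>(m, n)\<close> is eventually close to the values
  at the next \<open>N\<close> vertices of its row. Their squares sum to at most \<open>M\<close>, so the
  value at \<open>(m, n)\<close> is at most of order \<open>sqrt (M / N)\<close>, and \<open>N\<close> is arbitrary.
\<close>

lemma trunc_tendsto_0: "((\<lambda>t. trunc (u t (m, n))) \<longlongrightarrow> 0) at_top"
proof (rule tendstoI)
  fix e :: real assume e: "0 < e"
  define v where "v t k = trunc (u t (m + int k, n))" for t and k :: nat
  have row: "((\<lambda>t. v t k - v t 0) \<longlongrightarrow> 0) at_top" for k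
  proof (induction k)
    case (Suc k)
    have "{(m + int k, n), (m + int k + 1, n), (m + int k, n + 1)} \<in> F_H"
      unfolding in_F_H_iff up_face_def by blast
    from trunc_diff_tendsto_0[OF this]
    have "((\<lambda>t. v t k - v t (Suc k)) \<longlongrightarrow> 0) at_top" by (simp add: v_def ac_simps)
    from tendsto_diff[OF Suc this] show ?case by simp
  qed simp
  obtain N where N: "(2 * M + 1) / e\<^sup>2 < real N" using reals_Archimedean2 by blast
  have "((\<lambda>t. \<Sum>k<N. (v t k - v t 0)\<^sup>2) \<longlongrightarrow> (\<Sum>k<N. 0\<^sup>2)) at_top"
    by (intro tendsto_intros row)
  then have "((\<lambda>t. \<Sum>k<N. (v t k - v t 0)\<^sup>2) \<longlongrightarrow> 0) at_top" by simp
  then have "\<forall>\<^sub>F t in at_top. (\<Sum>k<N. (v t k - v t 0)\<^sup>2) < 1 / 2"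
    by (rule order_tendstoD(2)) simp
  then show "\<forall>\<^sub>F t in at_top. dist (trunc (u t (m, n))) 0 < e"
    using eventually_ge_at_top[of 0]
  proof eventually_elim
    case (elim t)
    have "(\<Sum>k<N. (v t k)\<^sup>2) \<le> (\<Sum>k<N. (u t (m + int k, n))\<^sup>2)"
      unfolding v_def by (intro sum_mono) (simp add: abs_le_square_iff[symmetric] abs_trunc_le)
    also have "\<dots> = (\<Sum>l\<in>(\<lambda>k. (m + int k, n)) ` {..<N}. (u t l)\<^sup>2)"
      by (subst sum.reindex) (auto simp: inj_on_def)
    also have "\<dots> \<le> M"
    proof -
      have "{(0, 0), (1, 0), (0, 1)} \<in> F_H"
        unfolding in_F_H_iff up_face_def by (rule exI[of _ 0], rule exI[of _ 0]) simp
      from energy_inequality[OF this elim(2), of "(\<lambda>k. (m + int k, n)) ` {..<N}"]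
      show ?thesis using dissipated_nonneg[of "(0, 0)" "(1, 0)" t] by simp
    qed
    finally have energy: "(\<Sum>k<N. (v t k)\<^sup>2) \<le> M" .
    \<comment> \<open>Compare \<open>N\<close> copies of the value at \<open>(m, n)\<close> with the values along the row.\<close>
    have "real N * (v t 0)\<^sup>2 = (\<Sum>k<N. (v t 0)\<^sup>2)" by simp
    also have "\<dots> \<le> (\<Sum>k<N. 2 * (v t k)\<^sup>2 + 2 * (v t k - v t 0)\<^sup>2)"
    proof (rule sum_mono)
      show "(v t 0)\<^sup>2 \<le> 2 * (v t k)\<^sup>2 + 2 * (v t k - v t 0)\<^sup>2" for k
        using zero_le_power2[of "2 * v t k - v t 0"] by (simp add: power2_eq_square algebra_simps)
    qed
    also have "\<dots> = 2 * (\<Sum>k<N. (v t k)\<^sup>2) + 2 * (\<Sum>k<N. (v t k - v t 0)\<^sup>2)"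
      by (simp add: sum.distrib sum_distrib_left)
    also have "\<dots> < 2 * M + 1" using energy elim(1) by linarith
    also have "\<dots> < real N * e\<^sup>2" using N e by (simp add: divide_less_eq)
    finally have "(v t 0)\<^sup>2 < e\<^sup>2" by (rule mult_left_less_imp_less) simp
    then have "\<bar>v t 0\<bar>\<^sup>2 < e\<^sup>2" by (simp only: power2_abs)
    then have "\<bar>v t 0\<bar> < e" by (rule power2_less_imp_less) (use e in simp)
    then show ?case by (simp add: v_def)
  qed
qed

lemma u_bounded:
  assumes "0 \<le> t"
  shows "\<bar>u t i\<bar> \<le> sqrt M"
proof -
  have "{(0, 0), (1, 0), (0, 1)} \<in> F_H"
    unfolding in_F_H_iff up_face_def by (rule exI[of _ 0], rule exI[of _ 0]) simp
  from energy_inequality[OF this assms, of "{i}"] have "(u t i)\<^sup>2 \<le> M"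
    using dissipated_nonneg[of "(0, 0)" "(1, 0)" t] by simp
  then show ?thesis by (simp add: real_le_rsqrt)
qed

lemma
  assumes M: "sqrt M \<le> \<delta>"
  shows global_solution_u: "global_solution \<phi> u"
    and u_tendsto_0: "((\<lambda>t. u t i) \<longlongrightarrow> 0) at_top"
proof -
  have small: "\<bar>u t i\<bar> \<le> \<delta>" if "0 \<le> t" for t i using u_bounded[OF that, of i] M by linarith
  then have eq: "trunc \<circ> u t = u t" if "0 \<le> t" for t using that by (auto simp: trunc_id)
  show "global_solution \<phi> u"
    unfolding global_solution_def
  proof (intro conjI allI impI)
    show "PL_metric (u t \<^bold>* d_reg)" if "0 \<le> t" for t by (intro PL_metric_near_regular small that)
    show "((\<lambda>s. u s i) has_real_derivative - curvature (u t) i) (at t within {0..})" if "0 \<le> t" for t i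
      using flow[OF that, of i] by (simp only: eq[OF that])
  qed (rule initial)
  have "((\<lambda>t. trunc (u t i)) \<longlongrightarrow> 0) at_top" by (cases i) (simp add: trunc_tendsto_0)
  moreover have "\<forall>\<^sub>F t in at_top. trunc (u t i) = u t i"
    using eventually_ge_at_top[of "0::real"] by eventually_elim (simp add: trunc_id small)
  ultimately show "((\<lambda>t. u t i) \<longlongrightarrow> 0) at_top" by (rule Lim_transform_eventually)
qed

end

section \<open>Existence and uniqueness\<close>

context near_regular
begin

text \<open>
  A vertex lies in six faces with three vertices each, whence the Lipschitz constant \<open>18\<close>.
\<close>

lemma truncated_flow_exists:
  assumes "\<And>A. finite A \<Longrightarrow> (\<Sum>i\<in>A. (\<phi> i)\<^sup>2) \<le> M"
  shows "\<exists>u. truncated_flow \<delta> \<phi> u M"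
proof -
  have t: "\<bar>(trunc \<circ> x) i\<bar> \<le> \<delta>" for x :: "vertex \<Rightarrow> real" and i by (simp add: abs_trunc_le)
  obtain u where u: "\<And>i. u 0 i = \<phi> i"
    "\<And>t i. t \<ge> 0 \<Longrightarrow> ((\<lambda>s. u s i) has_real_derivative - curvature (trunc \<circ> u t) i) (at t within {0..})"
  proof (rule picard_global_solution[of 18 "\<lambda>x i. - curvature (trunc \<circ> x) i" \<phi> "4 * pi"])
    fix x y :: "vertex \<Rightarrow> real" and i B
    assume B: "\<And>j. \<bar>x j - y j\<bar> \<le> B"
    have "\<bar>(trunc \<circ> x) j - (trunc \<circ> y) j\<bar> \<le> B" for j
      using order_trans[OF abs_trunc_diff_le B] by simp
    then have "\<bar>curvature (trunc \<circ> x) i - curvature (trunc \<circ> y) i\<bar> \<le> 18 * B"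
      by (intro curvature_lipschitz_sup t)
    then show "\<bar>- curvature (trunc \<circ> x) i - - curvature (trunc \<circ> y) i\<bar> \<le> 18 * B" by linarith
  next
    fix x :: "real \<Rightarrow> vertex \<Rightarrow> real" and i
    assume "\<And>j. continuous_on {0..} (\<lambda>s. x s j)"
    then have "continuous_on {0..} (\<lambda>s. (trunc \<circ> x s) j)" for j
      unfolding trunc_def comp_def by (intro continuous_intros)
    then show "continuous_on {0..} (\<lambda>s. - curvature (trunc \<circ> x s) i)"
      by (intro continuous_on_minus continuous_on_curvature t)
  next
    show "\<bar>- curvature (trunc \<circ> \<phi>) i\<bar> \<le> 4 * pi" for i
      unfolding abs_minus_cancel by (intro abs_curvature_le PL_metric_near_regular t)
  qed auto
  have "truncated_flow \<delta> \<phi> u M"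
    by unfold_locales (use u assms in auto)
  then show ?thesis by blast
qed

text \<open>
  Both solutions stay within \<open>\<delta>\<close> on \<open>[T, T + \<tau>]\<close>, the competitor because its speed is at
  most \<open>4 * pi\<close>. There the curvature has Lipschitz constant \<open>18\<close>, so any
  bound for the difference of the two solutions on an interval of length at most \<open>1 / 36\<close> improves to half of itself.
\<close>

lemma short_time_uniqueness:
  assumes u: "global_solution \<phi> u" and v: "global_solution \<phi> v"
    and small: "\<And>t i. 0 \<le> t \<Longrightarrow> \<bar>u t i\<bar> \<le> \<delta> / 2"
    and T: "0 \<le> T" "\<And>i. v T i = u T i"
    and \<tau>: "\<tau> \<le> 1 / 36" "\<tau> \<le> \<delta> / (8 * pi)" and t: "T \<le> t" "t \<le> T + \<tau>"
  shows "v t i = u t i"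
proof -
  have D: "0 \<le> s \<Longrightarrow> ((\<lambda>s. w s i) has_real_derivative - curvature (w s) i) (at s within {0..})"
    and PL: "0 \<le> s \<Longrightarrow> PL_metric (w s \<^bold>* d_reg)" if "global_solution \<phi> w" for w s i
    using that unfolding global_solution_def by blast+
  have v_small: "\<bar>v s i\<bar> \<le> \<delta>" if s: "T \<le> s" "s \<le> T + \<tau>" for s i
  proof -
    have "\<bar>v s i - v T i\<bar> \<le> 4 * pi * (s - T)"
      by (rule abs_diff_le_of_derivative_bound[OF D[OF v] T(1) s(1)])
        (use T(1) in \<open>auto intro!: abs_curvature_le PL[OF v]\<close>)
    also have "\<dots> \<le> 4 * pi * (\<delta> / (8 * pi))" using s \<tau> by (intro mult_left_mono) auto
    also have "\<dots> = \<delta> / 2" by simp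
    finally show ?thesis using small[OF T(1), of i] T(2)[of i] by linarith
  qed
  have contract: "\<bar>v s i - u s i\<bar> \<le> 2 * \<delta> / 2 ^ n" if "T \<le> s" "s \<le> T + \<tau>" for n s i
    using that
  proof (induction n arbitrary: s i)
    case 0
    then show ?case using v_small[of s i] small[of s i] T(1) \<delta>_pos by simp
  next
    case (Suc n)
    have "\<bar>(v s i - u s i) - (v T i - u T i)\<bar> \<le> 18 * (2 * \<delta> / 2 ^ n) * (s - T)"
    proof (rule abs_diff_le_of_derivative_bound[OF _ T(1) Suc.prems(1)])
      show "((\<lambda>s. v s i - u s i) has_real_derivative - curvature (v r) i - - curvature (u r) i) (at r within {0..})"
        if "0 \<le> r" for r
        by (intro DERIV_diff D u v that)
      fix r assume r: "T \<le> r" "r \<le> s"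
      have "\<bar>curvature (v r) i - curvature (u r) i\<bar> \<le> 18 * (2 * \<delta> / 2 ^ n)"
      proof (rule curvature_lipschitz_sup)
        show "\<bar>v r i\<bar> \<le> \<delta>" for i using v_small r Suc.prems by simp
        show "\<bar>u r i\<bar> \<le> \<delta>" for i using small[of r i] r T(1) \<delta>_pos by simp
        show "\<bar>v r i - u r i\<bar> \<le> 2 * \<delta> / 2 ^ n" for i using Suc.IH[of r i] r Suc.prems by simp
      qed
      then show "\<bar>- curvature (v r) i - - curvature (u r) i\<bar> \<le> 18 * (2 * \<delta> / 2 ^ n)" by linarith
    qed
    also have "\<dots> \<le> 18 * (2 * \<delta> / 2 ^ n) * (1 / 36)"
      using Suc.prems \<tau> \<delta>_pos by (intro mult_left_mono) auto
    finally show ?case using T(2)[of i] by simp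
  qed
  have "(\<lambda>n. 2 * \<delta> * (1 / 2) ^ n) \<longlonglongrightarrow> 2 * \<delta> * 0"
    by (intro tendsto_intros LIMSEQ_power_zero) simp
  then have "\<bar>v t i - u t i\<bar> \<le> 2 * \<delta> * 0"
    by (rule LIMSEQ_le_const) (use contract[OF t] in \<open>auto simp: power_divide\<close>)
  then show ?thesis by simp
qed

lemma global_uniqueness:
  assumes u: "global_solution \<phi> u" and v: "global_solution \<phi> v"
    and small: "\<And>t i. 0 \<le> t \<Longrightarrow> \<bar>u t i\<bar> \<le> \<delta> / 2" and t: "0 \<le> t"
  shows "v t i = u t i"
proof -
  \<comment> \<open>A step length that does not depend on the time reached so far.\<close>
  define \<tau> where "\<tau> = min (1 / 36) (\<delta> / (8 * pi))"
  have \<tau>: "\<tau> > 0" using \<delta>_pos by (simp add: \<tau>_def)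
  have steps: "\<forall>s i. 0 \<le> s \<and> s \<le> real n * \<tau> \<longrightarrow> v s i = u s i" for n
  proof (induction n)
    case 0
    then show ?case using u v by (auto simp: global_solution_def)
  next
    case (Suc n)
    show ?case
    proof (intro allI impI)
      fix s i assume s: "0 \<le> s \<and> s \<le> real (Suc n) * \<tau>"
      show "v s i = u s i"
      proof (cases "s \<le> real n * \<tau>")
        case True
        then show ?thesis using Suc s by blast
      next
        case False
        show ?thesis
        proof (rule short_time_uniqueness[OF u v small])
          show "0 \<le> real n * \<tau>" using \<tau> by simp
          then show "v (real n * \<tau>) i = u (real n * \<tau>) i" for i using Suc by blast
          show "\<tau> \<le> 1 / 36" "\<tau> \<le> \<delta> / (8 * pi)" by (simp_all only: \<tau>_def min.cobounded1 min.cobounded2)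
          show "real n * \<tau> \<le> s" using False by simp
          show "s \<le> real n * \<tau> + \<tau>" using s by (simp add: distrib_right)
        qed
      qed
    qed
  qed
  obtain n where "t / \<tau> < real n" using reals_Archimedean2 by blast
  then have "t \<le> real n * \<tau>" using \<tau> by (simp add: divide_less_eq)
  then show ?thesis using steps t by blast
qed

end

theorem theorem1p4:
  "\<exists>\<epsilon>\<^sub>0::real. \<epsilon>\<^sub>0 > 0 \<and>
     (\<forall>\<phi> :: vertex \<Rightarrow> real. in_l2 \<phi> \<and> l2_norm \<phi> \<le> \<epsilon>\<^sub>0 \<longrightarrow>
       (\<exists>u :: real \<Rightarrow> vertex \<Rightarrow> real.
          global_solution \<phi> u \<and>
          (\<forall>v. global_solution \<phi> v \<longrightarrow> (\<forall>t\<ge>0. \<forall>i. v t i = u t i)) \<and>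
          (\<forall>e\<in>E_H. ((\<lambda>t. (u t \<^bold>* d_reg) e) \<longlongrightarrow> 1) at_top)))"
proof -
  obtain \<delta> where "near_regular \<delta>" using near_regular_exists by blast
  then interpret near_regular \<delta> .
  show ?thesis
  proof (intro exI[of _ "\<delta> / 2"] conjI allI impI)
    show "\<delta> / 2 > 0" using \<delta>_pos by simp
    fix \<phi> :: "vertex \<Rightarrow> real" assume \<phi>: "in_l2 \<phi> \<and> l2_norm \<phi> \<le> \<delta> / 2"
    define M where "M = (\<Sum>\<^sub>\<infinity>i. \<bar>\<phi> i\<bar>\<^sup>2)"
    have sqrt_M: "sqrt M \<le> \<delta> / 2" using \<phi> by (simp add: M_def l2_norm_def)
    have "(\<Sum>i\<in>A. (\<phi> i)\<^sup>2) \<le> M" if "finite A" for A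
    proof -
      have "(\<Sum>i\<in>A. \<bar>\<phi> i\<bar>\<^sup>2) \<le> M"
        unfolding M_def by (rule finite_sum_le_infsum) (use \<phi> that in \<open>auto simp: in_l2_def\<close>)
      then show ?thesis by simp
    qed
    then obtain u where "truncated_flow \<delta> \<phi> u M" using truncated_flow_exists by blast
    then interpret truncated_flow \<delta> \<phi> u M .
    have M_le: "sqrt M \<le> \<delta>" using sqrt_M \<delta>_pos by simp
    have small: "\<bar>u t i\<bar> \<le> \<delta> / 2" if "0 \<le> t" for t i
      using u_bounded[OF that, of i] sqrt_M by simp
    show "\<exists>u. global_solution \<phi> u \<and>
        (\<forall>v. global_solution \<phi> v \<longrightarrow> (\<forall>t\<ge>0. \<forall>i. v t i = u t i)) \<and>
        (\<forall>e\<in>E_H. ((\<lambda>t. (u t \<^bold>* d_reg) e) \<longlongrightarrow> 1) at_top)"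
    proof (intro exI[of _ u] conjI allI impI ballI)
      show sol: "global_solution \<phi> u" by (rule global_solution_u[OF M_le])
      show "v t i = u t i" if "global_solution \<phi> v" "0 \<le> t" for v t i
        by (rule global_uniqueness[OF sol that(1) small that(2)])
      fix e assume "e \<in> E_H"
      then obtain i j where e: "e = {i, j}" "i \<noteq> j" by (auto simp: E_H_def)
      have "((\<lambda>t. exp ((u t i + u t j) / 2)) \<longlongrightarrow> exp ((0 + 0) / 2)) at_top"
        by (intro tendsto_intros u_tendsto_0[OF M_le]) simp
      then show "((\<lambda>t. (u t \<^bold>* d_reg) e) \<longlongrightarrow> 1) at_top"
        unfolding e conformal_edge[OF e(2)] by simp
    qed
  qed
qed

end
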